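(* Let $a < b$ be two positive integers such that $a+b$ is even, and let $n$ be an integer with $b < n - \frac{a+b}{2}$. Then the diagonal action of $\mathbb{P}GL(n)$ on $F\left(a, b, n - \frac{a+b}{2}; n\right)^3$ is not dense.
   Context: Work over an algebraically closed field. For integers $0 < k_1 < k_2 < k_3 < n$ and an $n$-dimensional vector space $V$, $F(k_1, k_2, k_3; n)$ denotes the partial flag variety parameterizing flags $W_{k_1} \subset W_{k_2} \subset W_{k_3} \subset V$ of linear subspaces with $\dim W_{k_i} = k_i$. The group $\mathbb{P}GL(n) = \mathbb{P}GL(V)$ acts on $F(k_1,k_2,k_3;n)$ and hence diagonally on the triple self-product $F(k_1,k_2,k_3;n)^3$. The action is called dense if it has a (Zariski) dense orbit. *)

theory Defs
  imports
    "HOL-Analysis.Analysis"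
    "HOL-Algebra.Group_Action"
    "Jordan_Normal_Form.Determinant"
begin

section \<open>The projective linear group and its action on lists of flags\<close>

definition GL :: "('k::field ^ 'n ^ 'n) monoid" where
  "GL = \<lparr>carrier = {A. invertible A}, monoid.mult = (**), one = Finite_Cartesian_Product.mat 1\<rparr>"

definition scalar_matrices :: "('k::field ^ 'n ^ 'n) set" where
  "scalar_matrices = {Finite_Cartesian_Product.mat c | c. c \<noteq> 0}"

definition PGL :: "('k::field ^ 'n ^ 'n) set monoid" where
  "PGL = GL Mod scalar_matrices"

text \<open>All representatives of a class in \<^term>\<open>PGL\<close> map a given subspace to the same subspace
  (see \<open>PGL_act_coset\<close> below), so the union of the images over the class is that subspace.\<close>

definition PGL_act :: "('k::field ^ 'n ^ 'n) set \<Rightarrow> ('k ^ 'n) set \<Rightarrow> ('k ^ 'n) set" where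
  "PGL_act C W = {A *v w | A w. A \<in> C \<and> w \<in> W}"

definition diagonal_act ::
  "('k::field ^ 'n ^ 'n) set \<Rightarrow> ('k ^ 'n) set list list \<Rightarrow> ('k ^ 'n) set list list" where
  "diagonal_act C = map (map (PGL_act C))"


section \<open>Partial flag varieties and their self-products\<close>

text \<open>Points of $F(k_1,\dots,k_r;n)$ with \<open>n = CARD('n)\<close>.\<close>

definition flag_variety :: "nat list \<Rightarrow> ('k::field ^ 'n) set list set" where
  "flag_variety ks =
    {Ws. (\<forall>W\<in>set Ws. vec.subspace W) \<and> map vec.dim Ws = ks \<and> sorted_wrt (\<subseteq>) Ws}"

definition self_product :: "nat \<Rightarrow> 'a set \<Rightarrow> 'a list set" where
  "self_product m X = {xs. length xs = m \<and> set xs \<subseteq> X}"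


section \<open>The diagonal action is a group action\<close>

lemma group_GL: "group (GL :: ('k::field ^ 'n ^ 'n) monoid)"
proof (rule groupI)
  fix A :: "'k ^ 'n ^ 'n" assume "A \<in> carrier GL"
  then obtain B where B: "A ** B = Finite_Cartesian_Product.mat 1" "B ** A = Finite_Cartesian_Product.mat 1"
    unfolding GL_def invertible_def by auto
  then have "B \<in> carrier GL" unfolding GL_def invertible_def by auto
  then show "\<exists>B\<in>carrier GL. B \<otimes>\<^bsub>GL\<^esub> A = \<one>\<^bsub>GL\<^esub>"
    by (rule bexI[rotated]) (simp add: GL_def B)
next
  have "invertible (Finite_Cartesian_Product.mat 1 :: 'k ^ 'n ^ 'n)"
    unfolding invertible_def by (intro exI[of _ "Finite_Cartesian_Product.mat 1"]) simp
  then show "\<one>\<^bsub>GL\<^esub> \<in> carrier (GL :: ('k ^ 'n ^ 'n) monoid)" by (simp add: GL_def)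
qed (simp_all add: GL_def invertible_mult matrix_mul_assoc)

lemma if_zero_mult:
  fixes c x :: "'a::comm_ring_1"
  shows "(if b then c else 0) * x = (if b then c * x else 0)" "x * (if b then c else 0) = (if b then c * x else 0)"
  by (simp_all add: mult.commute)

lemma scalar_mult_left_nth:
  "vec_nth (vec_nth (Finite_Cartesian_Product.mat c ** A) i) j = c * vec_nth (vec_nth (A :: 'k::field ^ 'n ^ 'n) i) j"
proof -
  have "vec_nth (vec_nth (Finite_Cartesian_Product.mat c ** A) i) j =
      (\<Sum>k\<in>UNIV. if i = k then c * vec_nth (vec_nth A k) j else 0)"
    by (simp add: matrix_matrix_mult_def Finite_Cartesian_Product.mat_def if_zero_mult)
  then show ?thesis by simp
qed

lemma scalar_mult_right_nth:
  "vec_nth (vec_nth (A ** Finite_Cartesian_Product.mat c) i) j = c * vec_nth (vec_nth (A :: 'k::field ^ 'n ^ 'n) i) j"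
proof -
  have "vec_nth (vec_nth (A ** Finite_Cartesian_Product.mat c) i) j =
      (\<Sum>k\<in>UNIV. if j = k then c * vec_nth (vec_nth A i) k else 0)"
    by (simp add: matrix_matrix_mult_def Finite_Cartesian_Product.mat_def if_zero_mult)
  then show ?thesis by simp
qed

lemma scalar_mult_commute:
  "A ** Finite_Cartesian_Product.mat c = Finite_Cartesian_Product.mat c ** (A :: 'k::field ^ 'n ^ 'n)"
  by (simp add: Finite_Cartesian_Product.vec_eq_iff scalar_mult_left_nth scalar_mult_right_nth)

lemma scalar_mult_scalar:
  "Finite_Cartesian_Product.mat c ** Finite_Cartesian_Product.mat d =
    (Finite_Cartesian_Product.mat (c * d) :: 'k::field ^ 'n ^ 'n)"
  unfolding Finite_Cartesian_Product.vec_eq_iff scalar_mult_left_nth by (simp add: Finite_Cartesian_Product.mat_def)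

lemma scalar_matrices_in_GL: "scalar_matrices \<subseteq> carrier (GL :: ('k::field ^ 'n ^ 'n) monoid)"
proof
  fix A :: "'k ^ 'n ^ 'n" assume "A \<in> scalar_matrices"
  then obtain c where c: "c \<noteq> 0" "A = Finite_Cartesian_Product.mat c"
    unfolding scalar_matrices_def by blast
  then have "A ** Finite_Cartesian_Product.mat (inverse c) = Finite_Cartesian_Product.mat 1"
    "Finite_Cartesian_Product.mat (inverse c) ** A = Finite_Cartesian_Product.mat 1"
    by (simp_all add: scalar_mult_scalar)
  then show "A \<in> carrier GL" unfolding GL_def invertible_def by auto
qed

lemma normal_scalar_matrices: "scalar_matrices \<lhd> (GL :: ('k::field ^ 'n ^ 'n) monoid)"
proof -
  interpret group "GL :: ('k ^ 'n ^ 'n) monoid" by (rule group_GL)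
  have scalar_in: "Finite_Cartesian_Product.mat c \<in> (scalar_matrices :: ('k ^ 'n ^ 'n) set)"
    if "c \<noteq> 0" for c
    using that unfolding scalar_matrices_def by blast
  have "subgroup scalar_matrices (GL :: ('k ^ 'n ^ 'n) monoid)"
  proof (rule subgroupI)
    show "scalar_matrices \<subseteq> carrier (GL :: ('k ^ 'n ^ 'n) monoid)"
      by (rule scalar_matrices_in_GL)
    show "scalar_matrices \<noteq> ({} :: ('k ^ 'n ^ 'n) set)"
      using scalar_in[OF one_neq_zero] by auto
  next
    fix A :: "'k ^ 'n ^ 'n" assume A: "A \<in> scalar_matrices"
    then obtain c where c: "c \<noteq> 0" "A = Finite_Cartesian_Product.mat c"
      unfolding scalar_matrices_def by blast
    let ?B = "Finite_Cartesian_Product.mat (inverse c) :: 'k ^ 'n ^ 'n"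
    have B: "?B \<in> scalar_matrices"
      by (rule scalar_in) (use c(1) in simp)
    have "inv\<^bsub>GL\<^esub> A = ?B"
      by (rule inv_equality)
        (use c A B scalar_matrices_in_GL in \<open>auto simp: GL_def scalar_mult_scalar\<close>)
    then show "inv\<^bsub>GL\<^esub> A \<in> scalar_matrices" using B by simp
  next
    fix A B :: "'k ^ 'n ^ 'n" assume "A \<in> scalar_matrices" "B \<in> scalar_matrices"
    then obtain c d where "c \<noteq> 0" "d \<noteq> 0"
      "A = Finite_Cartesian_Product.mat c" "B = Finite_Cartesian_Product.mat d"
      unfolding scalar_matrices_def by blast
    then show "A \<otimes>\<^bsub>GL\<^esub> B \<in> scalar_matrices"
      using scalar_in[of "c * d"] by (simp add: GL_def scalar_mult_scalar)
  qed
  moreover have "A \<otimes>\<^bsub>GL\<^esub> B \<otimes>\<^bsub>GL\<^esub> inv\<^bsub>GL\<^esub> A \<in> scalar_matrices"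
    if "A \<in> carrier GL" "B \<in> scalar_matrices" for A B :: "'k ^ 'n ^ 'n"
  proof -
    have B: "B \<in> carrier GL" using that scalar_matrices_in_GL by blast
    have "A \<otimes>\<^bsub>GL\<^esub> B = B \<otimes>\<^bsub>GL\<^esub> A"
      using that unfolding scalar_matrices_def GL_def by (auto simp: scalar_mult_commute)
    then have "A \<otimes>\<^bsub>GL\<^esub> B \<otimes>\<^bsub>GL\<^esub> inv\<^bsub>GL\<^esub> A = B"
      using that B by (simp add: m_assoc)
    then show ?thesis using that by simp
  qed
  ultimately show ?thesis unfolding normal_inv_iff by blast
qed

lemma group_PGL: "group PGL"
  unfolding PGL_def by (rule normal.factorgroup_is_group[OF normal_scalar_matrices])

lemma carrier_PGL: "carrier PGL = (\<lambda>A. scalar_matrices #>\<^bsub>GL\<^esub> A) ` {A. invertible A}"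
  unfolding PGL_def FactGroup_def RCOSETS_def by (auto simp: GL_def)

lemma PGL_act_coset:
  fixes A :: "'k::field ^ 'n ^ 'n"
  assumes "vec.subspace W"
  shows "PGL_act (scalar_matrices #>\<^bsub>GL\<^esub> A) W = (*v) A ` W"
proof -
  have eq: "(Finite_Cartesian_Product.mat c ** A) *v w = A *v (c *s w)" for c w
  proof -
    have "vec_nth (Finite_Cartesian_Product.mat c *v w) i = (\<Sum>k\<in>UNIV. if i = k then c * vec_nth w k else 0)"
      for w :: "'k ^ 'n" and i
      by (simp add: matrix_vector_mult_def Finite_Cartesian_Product.mat_def if_zero_mult)
    then have "Finite_Cartesian_Product.mat c *v w = c *s w" for w :: "'k ^ 'n"
      by (simp add: Finite_Cartesian_Product.vec_eq_iff)
    then show ?thesis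
      by (simp add: matrix_vector_mul_assoc[symmetric] scalar_mult_commute[symmetric])
  qed
  show ?thesis
  proof (intro equalityI subsetI)
    fix v assume "v \<in> PGL_act (scalar_matrices #>\<^bsub>GL\<^esub> A) W"
    then obtain c w where "w \<in> W" "v = (Finite_Cartesian_Product.mat c ** A) *v w"
      unfolding PGL_act_def r_coset_def scalar_matrices_def GL_def by auto
    then show "v \<in> (*v) A ` W" using vec.subspace_scale[OF assms] by (auto simp: eq)
  next
    fix v assume "v \<in> (*v) A ` W"
    then obtain w where w: "w \<in> W" "v = A *v w" by blast
    have "A \<in> scalar_matrices #>\<^bsub>GL\<^esub> A"
      unfolding r_coset_def scalar_matrices_def GL_def
      by (auto intro!: bexI[of _ "Finite_Cartesian_Product.mat 1"] exI[of _ "1::'k"])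
    then show "v \<in> PGL_act (scalar_matrices #>\<^bsub>GL\<^esub> A) W"
      unfolding PGL_act_def using w by blast
  qed
qed

lemma diagonal_act_coset:
  fixes A :: "'k::field ^ 'n ^ 'n"
  assumes "x \<in> self_product m (flag_variety ks)"
  shows "diagonal_act (scalar_matrices #>\<^bsub>GL\<^esub> A) x = map (map ((`) ((*v) A))) x"
proof -
  have "PGL_act (scalar_matrices #>\<^bsub>GL\<^esub> A) W = (*v) A ` W" if "Ws \<in> set x" "W \<in> set Ws" for Ws W
    by (rule PGL_act_coset) (use assms that in \<open>auto simp: self_product_def flag_variety_def\<close>)
  then show ?thesis
    unfolding diagonal_act_def by simp
qed

lemma map_image_flag:
  fixes A :: "'k::field ^ 'n ^ 'n"
  assumes "x \<in> self_product m (flag_variety ks)" "invertible A"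
  shows "map (map ((`) ((*v) A))) x \<in> self_product m (flag_variety ks)"
proof -
  obtain B where B: "B ** A = Finite_Cartesian_Product.mat 1"
    using assms(2) unfolding invertible_def by blast
  have inj: "inj ((*v) A)"
    using B by (metis matrix_left_invertible_injective)
  have dim: "vec.dim ((*v) A ` W) = vec.dim W" if "vec.subspace W" for W
    by (rule vec.dim_image_eq) (use inj in \<open>auto simp: inj_on_def inj_def intro: matrix_vector_mul_linear_gen\<close>)
  have "map ((`) ((*v) A)) Ws \<in> flag_variety ks" if Ws: "Ws \<in> flag_variety ks" for Ws :: "('k ^ 'n) set list"
  proof -
    have "sorted_wrt (\<subseteq>) (map ((`) ((*v) A)) Ws)"
      using Ws unfolding flag_variety_def sorted_wrt_map
      by (auto elim!: sorted_wrt_mono_rel[rotated])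
    moreover have "map vec.dim (map ((`) ((*v) A)) Ws) = ks"
      using Ws dim unfolding flag_variety_def by auto
    moreover have "vec.subspace ((*v) A ` W)" if "W \<in> set Ws" for W
      using Ws that unfolding flag_variety_def
      by (auto intro: vec.subspace_image matrix_vector_mul_linear_gen)
    ultimately show ?thesis unfolding flag_variety_def by auto
  qed
  then show ?thesis using assms(1) unfolding self_product_def by auto
qed

lemma diagonal_act_group_action:
  fixes E :: "('k::field ^ 'n) set list list set"
  assumes E_def: "E = self_product m (flag_variety ks)"
  shows "group_action PGL E (\<lambda>C. restrict (diagonal_act C) E)"
proof -
  define act where "act A = map (map ((`) ((*v) A)))" for A :: "'k ^ 'n ^ 'n"
  interpret normal scalar_matrices "GL :: ('k ^ 'n ^ 'n) monoid" by (rule normal_scalar_matrices)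
  have cl: "act A x \<in> E" if "x \<in> E" "invertible A" for A x
    using map_image_flag that unfolding E_def act_def by blast
  have comp: "act A (act B x) = act (A ** B) x" for A B x
    unfolding act_def by (simp add: image_image matrix_vector_mul_assoc)
  have one: "act (Finite_Cartesian_Product.mat 1) x = x" for x
    unfolding act_def by (simp add: map_idI)
  have coset: "diagonal_act (scalar_matrices #>\<^bsub>GL\<^esub> A) x = act A x" if "x \<in> E" for A x
    using diagonal_act_coset that unfolding E_def act_def by blast
  have bij: "bij_betw (act A) E E" if "invertible A" for A
  proof -
    obtain B where B: "A ** B = Finite_Cartesian_Product.mat 1" "B ** A = Finite_Cartesian_Product.mat 1"
      using \<open>invertible A\<close> unfolding invertible_def by blast
    then have "invertible B" unfolding invertible_def by blast
    then show ?thesis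
      by (intro bij_betw_byWitness[where f' = "act B"]) (use that B cl in \<open>auto simp: comp one\<close>)
  qed
  have "(\<lambda>C. restrict (diagonal_act C) E) \<in> hom PGL (BijGroup E)"
  proof (rule homI)
    fix C :: "('k ^ 'n ^ 'n) set" assume "C \<in> carrier PGL"
    then obtain A where A: "invertible A" "C = scalar_matrices #>\<^bsub>GL\<^esub> A"
      unfolding carrier_PGL by blast
    have "bij_betw (diagonal_act C) E E"
      using bij[OF A(1)] coset A(2) by (metis bij_betw_cong)
    then show "restrict (diagonal_act C) E \<in> carrier (BijGroup E)"
      by (simp add: BijGroup_def Bij_def)
  next
    fix C D :: "('k ^ 'n ^ 'n) set" assume "C \<in> carrier PGL" "D \<in> carrier PGL"
    then obtain A B where A: "invertible A" "C = scalar_matrices #>\<^bsub>GL\<^esub> A"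
      and B: "invertible B" "D = scalar_matrices #>\<^bsub>GL\<^esub> B"
      unfolding carrier_PGL by blast
    have "C <#>\<^bsub>GL\<^esub> D = scalar_matrices #>\<^bsub>GL\<^esub> (A \<otimes>\<^bsub>GL\<^esub> B)"
      unfolding A B by (rule rcos_sum) (use A B in \<open>auto simp: GL_def\<close>)
    then have CD: "C \<otimes>\<^bsub>PGL\<^esub> D = scalar_matrices #>\<^bsub>GL\<^esub> (A ** B)"
      unfolding PGL_def FactGroup_def by (simp add: GL_def)
    have bij': "bij_betw (diagonal_act C) E E" "bij_betw (diagonal_act D) E E"
      using bij A B coset by (metis bij_betw_cong)+
    show "restrict (diagonal_act (C \<otimes>\<^bsub>PGL\<^esub> D)) E =
      restrict (diagonal_act C) E \<otimes>\<^bsub>BijGroup E\<^esub> restrict (diagonal_act D) E"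
      using bij' unfolding CD unfolding A(2) B(2)
      by (auto simp: BijGroup_def Bij_def coset comp compose_def cl B(1) fun_eq_iff)
  qed
  then show ?thesis
    unfolding group_action_def group_hom_def group_hom_axioms_def
    using group_PGL group_BijGroup by blast
qed


section \<open>The Zariski topology\<close>

definition is_basis :: "('k::field ^ 'n) list \<Rightarrow> ('k ^ 'n) set \<Rightarrow> bool" where
  "is_basis ws W \<longleftrightarrow> distinct ws \<and> vec.independent (set ws) \<and> vec.span (set ws) = W"

text \<open>The Pluecker coordinate indexed by a tuple \<open>s\<close> of rows. All tuples of the right length are
  allowed, not only the increasing ones; up to sign this merely repeats coordinates or adds zeros.\<close>

definition pluecker :: "('k::field ^ 'n) list \<Rightarrow> 'n list \<Rightarrow> 'k" where
  "pluecker ws s =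
    (if length s = length ws
     then Determinant.det (Matrix.mat (length ws) (length ws) (\<lambda>(i, j). vec_nth (ws ! j) (s ! i)))
     else 0)"

text \<open>The systems of multihomogeneous coordinates of a list of subspaces, i.e. of a point in a
  product of Grassmannians embedded into a product of projective spaces.\<close>

definition hom_coords :: "('k::field ^ 'n) set list \<Rightarrow> (nat \<Rightarrow> 'n list \<Rightarrow> 'k) set" where
  "hom_coords Ws =
    {\<lambda>i. if i < length Ws then pluecker (B i) else (\<lambda>_. 0) | B. \<forall>i<length Ws. is_basis (B i) (Ws ! i)}"

text \<open>\<open>multihom d f\<close>: \<open>f\<close> is given by a polynomial in variables \<open>p i s\<close> that is homogeneous of degree
  \<open>d i\<close> in the \<open>i\<close>-th block of variables \<open>p i\<close>, for every \<open>i\<close>.\<close>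

inductive multihom :: "('i \<Rightarrow> nat) \<Rightarrow> (('i \<Rightarrow> 'c \<Rightarrow> 'k::comm_ring_1) \<Rightarrow> 'k) \<Rightarrow> bool" where
  const: "multihom (\<lambda>_. 0) (\<lambda>p. c)"
| var: "multihom (\<lambda>j. if j = i then 1 else 0) (\<lambda>p. p i s)"
| add: "multihom d f \<Longrightarrow> multihom d g \<Longrightarrow> multihom d (\<lambda>p. f p + g p)"
| mult: "multihom d f \<Longrightarrow> multihom e g \<Longrightarrow> multihom (\<lambda>i. d i + e i) (\<lambda>p. f p * g p)"

definition multiforms :: "((nat \<Rightarrow> 'n list \<Rightarrow> 'k::comm_ring_1) \<Rightarrow> 'k) set" where
  "multiforms = {f. \<exists>d. multihom d f}"

text \<open>By \<open>multiform_vanishes_iff\<close> below, the choice of coordinates is immaterial.\<close>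

definition zero_locus ::
  "('k::field ^ 'n) set list list set \<Rightarrow> ((nat \<Rightarrow> 'n list \<Rightarrow> 'k) \<Rightarrow> 'k) set
    \<Rightarrow> ('k ^ 'n) set list list set" where
  "zero_locus X S = {x \<in> X. \<forall>f\<in>S. \<forall>p\<in>hom_coords (concat x). f p = 0}"

text \<open>The topology on a set of lists of flags whose closed sets are the zero loci; see
  \<open>closedin_zariski\<close> below.\<close>

definition zariski :: "('k::field ^ 'n) set list list set \<Rightarrow> ('k ^ 'n) set list list topology" where
  "zariski X = topology (\<lambda>U. \<exists>S\<subseteq>multiforms. U = X - zero_locus X S)"

lemma pluecker_span:
  assumes "set vs \<subseteq> vec.span (set ws)" "distinct ws" "length vs = length ws"
  shows "\<exists>c. \<forall>s. pluecker vs s = c * pluecker ws s"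
proof -
  define k where "k = length ws"
  have "\<exists>u. vs ! j = (\<Sum>l<k. u l *s ws ! l)" if "j < k" for j
  proof -
    have "vs ! j \<in> vec.span (set ws)"
      using assms that by (auto simp: k_def)
    then obtain u where "vs ! j = (\<Sum>v\<in>set ws. u v *s v)"
      by (auto simp: vec.span_finite)
    also have "\<dots> = (\<Sum>l<k. u (ws ! l) *s ws ! l)"
      by (rule sum.reindex_bij_betw [symmetric, OF bij_betw_nth]) (use assms in \<open>auto simp: k_def\<close>)
    finally show ?thesis
      by (intro exI[of _ "\<lambda>l. u (ws ! l)"])
  qed
  then obtain u where u: "\<And>j. j < k \<Longrightarrow> vs ! j = (\<Sum>l<k. u j l *s ws ! l)"
    by metis
  define C where "C = Matrix.mat k k (\<lambda>(l, j). u j l)"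
  have "pluecker vs s = Determinant.det C * pluecker ws s" for s
  proof (cases "length s = k")
    case True
    define M where "M = Matrix.mat k k (\<lambda>(i, j). vec_nth (ws ! j) (s ! i))"
    have "Matrix.mat k k (\<lambda>(i, j). vec_nth (vs ! j) (s ! i)) = M * C"
      by (rule eq_matI)
        (auto simp: M_def C_def u scalar_prod_def atLeast0LessThan mult.commute intro!: sum.cong)
    moreover have "Determinant.det (M * C) = Determinant.det M * Determinant.det C"
      by (rule det_mult[of _ k]) (auto simp: M_def C_def)
    ultimately show ?thesis
      using True assms by (simp add: pluecker_def M_def k_def)
  qed (use assms in \<open>auto simp: pluecker_def k_def\<close>)
  then show ?thesis by blast
qed

lemma length_is_basis: "is_basis ws W \<Longrightarrow> length ws = vec.dim W"
  unfolding is_basis_def by (metis distinct_card vec.dim_span_eq_card_independent)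

lemma pluecker_is_basis_unique:
  assumes "is_basis vs W" "is_basis ws W"
  shows "\<exists>c. c \<noteq> 0 \<and> (\<forall>s. pluecker vs s = c * pluecker ws s)"
proof -
  have len: "length vs = length ws"
    using assms by (simp add: length_is_basis)
  have "set vs \<subseteq> vec.span (set ws)" "set ws \<subseteq> vec.span (set vs)"
    using assms unfolding is_basis_def by (metis vec.span_superset)+
  then obtain c d where c: "\<And>s. pluecker vs s = c * pluecker ws s"
    and d: "\<And>s. pluecker ws s = d * pluecker vs s"
    using pluecker_span len assms unfolding is_basis_def by metis
  show ?thesis
  proof (cases "c = 0")
    case True
    then have "pluecker vs s = 1 * pluecker ws s" for s
      using c[of s] d[of s] by simp
    then show ?thesis by (intro exI[of _ 1]) auto
  qed (use c in auto)
qed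

lemma multihom_scale:
  fixes f :: "('i \<Rightarrow> 'c \<Rightarrow> 'k::comm_ring_1) \<Rightarrow> 'k"
  assumes "multihom d f"
  shows "finite {i. d i \<noteq> 0} \<and> f (\<lambda>i s. c i * p i s) = (\<Prod>i | d i \<noteq> 0. c i ^ d i) * f p"
  using assms
proof induction
  case (var i s)
  have "{j. (if j = i then 1 else 0 :: nat) \<noteq> 0} = {i}" by auto
  then show ?case by simp
next
  case (mult d f e g)
  let ?A = "{i. d i \<noteq> 0} \<union> {i. e i \<noteq> 0}"
  have fin: "finite ?A" using mult by simp
  have d: "(\<Prod>i | d i \<noteq> 0. c i ^ d i) = (\<Prod>i\<in>?A. c i ^ d i)"
    and e: "(\<Prod>i | e i \<noteq> 0. c i ^ e i) = (\<Prod>i\<in>?A. c i ^ e i)"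
    by (rule prod.mono_neutral_left; use fin in auto)+
  have "{i. d i + e i \<noteq> 0} = ?A" by auto
  then show ?case
    using mult fin d e by (simp add: power_add prod.distrib algebra_simps)
qed (auto simp: algebra_simps)

lemma multiform_vanishes_iff:
  assumes "f \<in> multiforms" "p \<in> hom_coords Ws" "q \<in> hom_coords Ws"
  shows "f p = 0 \<longleftrightarrow> f q = 0"
proof -
  have imp: "f p = 0"
    if p: "p \<in> hom_coords Ws" and q: "q \<in> hom_coords Ws" and "f q = 0" for p q
  proof -
    obtain B where B: "\<And>i. i < length Ws \<Longrightarrow> is_basis (B i) (Ws ! i)"
      and p_eq: "p = (\<lambda>i. if i < length Ws then pluecker (B i) else (\<lambda>_. 0))"
      using p unfolding hom_coords_def by blast
    obtain B' where B': "\<And>i. i < length Ws \<Longrightarrow> is_basis (B' i) (Ws ! i)"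
      and q_eq: "q = (\<lambda>i. if i < length Ws then pluecker (B' i) else (\<lambda>_. 0))"
      using q unfolding hom_coords_def by blast
    have "\<forall>i. \<exists>c. \<forall>s. p i s = c * q i s"
      using pluecker_is_basis_unique[OF B B'] unfolding p_eq q_eq by auto
    then obtain c where c: "p = (\<lambda>i s. c i * q i s)"
      by (metis ext)
    obtain d where "multihom d f" using assms unfolding multiforms_def by blast
    then show ?thesis
      unfolding c using multihom_scale[of d f c q] \<open>f q = 0\<close> by simp
  qed
  show ?thesis using imp assms by blast
qed

lemma multiforms_mult:
  assumes "f \<in> multiforms" "g \<in> multiforms"
  shows "(\<lambda>p. f p * g p) \<in> multiforms"
proof -
  obtain d e where "multihom d f" "multihom e g"
    using assms unfolding multiforms_def by blast
  from multihom.mult[OF this] show ?thesis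
    unfolding multiforms_def by (intro CollectI exI)
qed

lemma istopology_zariski: "istopology (\<lambda>U. \<exists>S\<subseteq>multiforms. U = X - zero_locus X S)"
  unfolding istopology_def
proof (intro conjI allI impI)
  fix U V
  assume "\<exists>S\<subseteq>multiforms. U = X - zero_locus X S" "\<exists>S\<subseteq>multiforms. V = X - zero_locus X S"
  then obtain S T where S: "S \<subseteq> multiforms" "U = X - zero_locus X S"
    and T: "T \<subseteq> multiforms" "V = X - zero_locus X T" by blast
  define R where "R = (\<lambda>(f, g) p. f p * g p) ` (S \<times> T)"
  have "R \<subseteq> multiforms"
    using S(1) T(1) multiforms_mult unfolding R_def by auto
  moreover have "U \<inter> V = X - zero_locus X R"
  proof (intro equalityI subsetI)
    fix x assume x: "x \<in> U \<inter> V"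
    then obtain f p where f: "f \<in> S" "p \<in> hom_coords (concat x)" "f p \<noteq> 0"
      unfolding S(2) zero_locus_def by blast
    obtain g q where g: "g \<in> T" "q \<in> hom_coords (concat x)" "g q \<noteq> 0"
      using x unfolding T(2) zero_locus_def by blast
    have "g p \<noteq> 0" using multiform_vanishes_iff f g T(1) by blast
    then have "(\<lambda>p. f p * g p) p \<noteq> 0" using f by simp
    moreover have "(\<lambda>p. f p * g p) \<in> R"
      unfolding R_def using f g by (intro image_eqI[of _ _ "(f, g)"]) auto
    ultimately have "x \<notin> zero_locus X R"
      using f(2) unfolding zero_locus_def mem_Collect_eq by fast
    then show "x \<in> X - zero_locus X R" using x S(2) by blast
  next
    fix x assume "x \<in> X - zero_locus X R"
    then obtain h p where "x \<in> X" "h \<in> R" "p \<in> hom_coords (concat x)" "h p \<noteq> 0"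
      unfolding zero_locus_def by blast
    moreover from this obtain f g where "f \<in> S" "g \<in> T" "h = (\<lambda>p. f p * g p)"
      unfolding R_def by auto
    ultimately have "x \<in> X" "f \<in> S" "g \<in> T" "p \<in> hom_coords (concat x)" "f p \<noteq> 0" "g p \<noteq> 0"
      by auto
    then show "x \<in> U \<inter> V" unfolding S(2) T(2) zero_locus_def by fast
  qed
  ultimately show "\<exists>R\<subseteq>multiforms. U \<inter> V = X - zero_locus X R" by (intro exI[of _ R] conjI)
next
  fix K assume K: "\<forall>U\<in>K. \<exists>S\<subseteq>multiforms. U = X - zero_locus X S"
  let ?R = "\<Union>{S. S \<subseteq> multiforms \<and> X - zero_locus X S \<in> K}"
  have "\<Union>K \<subseteq> X - zero_locus X ?R"
  proof
    fix x assume "x \<in> \<Union>K"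
    then obtain U where U: "U \<in> K" "x \<in> U" by blast
    then obtain S where S: "S \<subseteq> multiforms" "U = X - zero_locus X S" using K by blast
    then have "S \<subseteq> ?R" using U by blast
    then have "zero_locus X ?R \<subseteq> zero_locus X S"
      unfolding zero_locus_def by blast
    then show "x \<in> X - zero_locus X ?R" using U S by blast
  qed
  moreover have "X - zero_locus X ?R \<subseteq> \<Union>K"
  proof
    fix x assume "x \<in> X - zero_locus X ?R"
    then obtain S f p where "S \<subseteq> multiforms" "X - zero_locus X S \<in> K" "x \<in> X" "f \<in> S"
      "p \<in> hom_coords (concat x)" "f p \<noteq> 0"
      unfolding zero_locus_def by blast
    then show "x \<in> \<Union>K" unfolding zero_locus_def by blast
  qed
  ultimately have "\<Union>K = X - zero_locus X ?R" by (rule equalityI)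
  moreover have "?R \<subseteq> multiforms" by blast
  ultimately show "\<exists>S\<subseteq>multiforms. \<Union>K = X - zero_locus X S" by (intro exI[of _ ?R] conjI)
qed

lemma openin_zariski:
  "openin (zariski X) U \<longleftrightarrow> (\<exists>S\<subseteq>multiforms. U = X - zero_locus X S)"
  unfolding zariski_def by (simp only: topology_inverse'[OF istopology_zariski])

lemma hom_coords_nonempty:
  fixes Ws :: "('k::field ^ 'n) set list"
  assumes "\<forall>W\<in>set Ws. vec.subspace W"
  shows "hom_coords Ws \<noteq> {}"
proof -
  have "\<exists>ws. is_basis ws W" if "vec.subspace W" for W :: "('k ^ 'n) set"
  proof -
    obtain B where B: "B \<subseteq> W" "vec.independent B" "W \<subseteq> vec.span B" "card B = vec.dim W"
      by (rule vec.basis_exists)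
    have "vec.span B = W"
      using B that by (simp add: vec.span_minimal subset_antisym)
    moreover obtain ws where "distinct ws" "set ws = B"
      using finite_distinct_list[OF vec.finiteI_independent[OF B(2)]] by metis
    ultimately show ?thesis
      using B(2) by (intro exI[of _ ws]) (simp add: is_basis_def)
  qed
  then have "\<forall>W::('k ^ 'n) set. \<exists>ws. vec.subspace W \<longrightarrow> is_basis ws W" by blast
  from choice[OF this] obtain B :: "('k ^ 'n) set \<Rightarrow> ('k ^ 'n) list"
    where "\<And>W. vec.subspace W \<Longrightarrow> is_basis (B W) W" by blast
  then have "\<forall>i<length Ws. is_basis (B (Ws ! i)) (Ws ! i)" using assms by simp
  then have "(\<lambda>i. if i < length Ws then pluecker (B (Ws ! i)) else (\<lambda>_. 0)) \<in> hom_coords Ws"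
    unfolding hom_coords_def by (intro CollectI exI[of _ "\<lambda>i. B (Ws ! i)"] conjI refl)
  then show ?thesis by blast
qed

lemma topspace_zariski:
  assumes "X \<subseteq> self_product m (flag_variety ks)"
  shows "topspace (zariski X) = X"
proof -
  have "zero_locus X {\<lambda>p. 1} = {}"
  proof -
    have "hom_coords (concat x) \<noteq> {}" if "x \<in> X" for x
      by (rule hom_coords_nonempty)
        (use that assms in \<open>auto simp: self_product_def flag_variety_def subset_iff\<close>)
    then show ?thesis unfolding zero_locus_def by auto
  qed
  moreover have "(\<lambda>p. 1) \<in> multiforms"
    unfolding multiforms_def using multihom.const by blast
  ultimately have "openin (zariski X) X"
    unfolding openin_zariski by (intro exI[of _ "{\<lambda>p. 1}"]) auto
  moreover have "topspace (zariski X) \<subseteq> X"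
    using openin_topspace[of "zariski X"] unfolding openin_zariski by blast
  ultimately show ?thesis by (meson openin_subset subset_antisym)
qed

lemma closedin_zariski:
  assumes "X \<subseteq> self_product m (flag_variety ks)"
  shows "closedin (zariski X) Z \<longleftrightarrow> (\<exists>S\<subseteq>multiforms. Z = zero_locus X S)"
proof -
  have sub: "zero_locus X S \<subseteq> X" for S unfolding zero_locus_def by blast
  have "Z \<subseteq> X \<and> X - Z = X - zero_locus X S \<longleftrightarrow> Z = zero_locus X S" for S
    using sub[of S] by blast
  then show ?thesis
    unfolding closedin_def topspace_zariski[OF assms] openin_zariski by blast
qed


section \<open>Dense actions\<close>

definition dense_action :: "('k::field ^ 'n) set list list set \<Rightarrow> bool" where
  "dense_action X \<longleftrightarrow> (\<exists>x\<in>X. zariski X closure_of Group_Action.orbit PGL diagonal_act x = X)"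

end

theory Submission
  imports Defs
begin

text \<open>Write \<open>A\<^sub>i \<subseteq> B\<^sub>i \<subseteq> C\<^sub>i\<close> for the three flags. Put \<open>m = (a + b) / 2\<close>, so that the
  quotient \<open>Q = V / C\<^sub>3\<close> has dimension \<open>m\<close>, and let \<open>K\<^sub>1 = B\<^sub>1 \<inter> C\<^sub>2\<close> and \<open>K\<^sub>2 = B\<^sub>2 \<inter> C\<^sub>1\<close>; generically
  both have dimension \<open>b - m = m - a\<close>. Hence the images of \<open>A\<^sub>1\<close>, \<open>A\<^sub>2\<close> in \<open>Q\<close> are complementary in
  dimension to those of \<open>K\<^sub>1\<close>, \<open>K\<^sub>2\<close>, and the four subspaces have a cross ratio
  \<open>[A\<^sub>1, K\<^sub>1] [A\<^sub>2, K\<^sub>2] / ([A\<^sub>1, K\<^sub>2] [A\<^sub>2, K\<^sub>1])\<close>, which is an invariant rational function. It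
  is a quotient of two multiforms of the same multidegree and the same weight, and it takes both
  values \<open>0\<close> and \<open>\<infinity>\<close>; on a dense orbit it would be constant.\<close>


section \<open>Alternating forms and Pluecker coordinates\<close>

text \<open>Alternation is vanishing on equal entries, since a mere sign change under swaps would be
  too weak in characteristic 2. Only lists of length \<open>k\<close> are constrained.\<close>

definition alternating_form :: "nat \<Rightarrow> (('k::field ^ 'n) list \<Rightarrow> 'k) \<Rightarrow> bool" where
  "alternating_form k g \<longleftrightarrow>
    (\<forall>ws i x y. length ws = k \<longrightarrow> i < k \<longrightarrow> g (ws[i := x + y]) = g (ws[i := x]) + g (ws[i := y])) \<and>
    (\<forall>ws i c x. length ws = k \<longrightarrow> i < k \<longrightarrow> g (ws[i := c *s x]) = c * g (ws[i := x])) \<and>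
    (\<forall>ws i j. length ws = k \<longrightarrow> i < k \<longrightarrow> j < k \<longrightarrow> i \<noteq> j \<longrightarrow> ws ! i = ws ! j \<longrightarrow> g ws = 0)"

lemma
  assumes "alternating_form k g" "length ws = k" "i < k"
  shows alternating_form_add: "g (ws[i := x + y]) = g (ws[i := x]) + g (ws[i := y])"
    and alternating_form_scale: "g (ws[i := c *s x]) = c * g (ws[i := x])"
    and alternating_form_eq: "j < k \<Longrightarrow> i \<noteq> j \<Longrightarrow> ws ! i = ws ! j \<Longrightarrow> g ws = 0"
  using assms unfolding alternating_form_def by blast+

lemma alternating_form_diff:
  assumes "alternating_form k g" "alternating_form k h"
  shows "alternating_form k (\<lambda>ws. g ws - h ws)"
  using assms unfolding alternating_form_def by (simp add: algebra_simps)

lemma alternating_form_sum: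
  assumes "\<And>s. s \<in> S \<Longrightarrow> alternating_form k (g s)"
  shows "alternating_form k (\<lambda>ws. \<Sum>s\<in>S. c s * g s ws)"
proof -
  have "(\<Sum>s\<in>S. c s * g s (ws[i := x + y])) =
      (\<Sum>s\<in>S. c s * g s (ws[i := x])) + (\<Sum>s\<in>S. c s * g s (ws[i := y]))"
    "(\<Sum>s\<in>S. c s * g s (ws[i := b *s x])) = b * (\<Sum>s\<in>S. c s * g s (ws[i := x]))"
    if "length ws = k" "i < k" for ws i x y b
    using alternating_form_add[OF assms that] alternating_form_scale[OF assms that]
    by (simp_all add: sum_distrib_left algebra_simps flip: sum.distrib)
  moreover have "(\<Sum>s\<in>S. c s * g s ws) = 0"
    if "length ws = k" "i < k" "j < k" "i \<noteq> j" "ws ! i = ws ! j" for ws i j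
    using alternating_form_eq[OF assms that(1,2)] that by (intro sum.neutral) auto
  ultimately show ?thesis
    unfolding alternating_form_def by blast
qed

text \<open>Polarization: put the sum of the two entries into both slots and expand; the terms with
  a repeated entry vanish.\<close>

lemma alternating_form_swap:
  assumes g: "alternating_form k g" and ws: "length ws = k" "i < k" "j < k" "i \<noteq> j"
  shows "g (ws[i := ws ! j, j := ws ! i]) = - g ws"
proof -
  define w where "w x y = ws[i := x, j := y]" for x y
  have w': "w x y = ws[j := y, i := x]" for x y
    unfolding w_def using ws by (simp add: list_update_swap)
  have 1: "g (w (x + x') y) = g (w x y) + g (w x' y)" for x x' y
    unfolding w' using g ws by (intro alternating_form_add) auto
  have 2: "g (w x (y + y')) = g (w x y) + g (w x y')" for x y y'
    unfolding w_def using g ws by (intro alternating_form_add) auto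
  have 3: "g (w x x) = 0" for x
    by (rule alternating_form_eq[OF g, of _ i j]) (use ws in \<open>auto simp: w_def\<close>)
  have "0 = g (w (ws ! i + ws ! j) (ws ! i + ws ! j))"
    using 3 by simp
  also have "\<dots> = g (w (ws ! i) (ws ! j)) + g (w (ws ! j) (ws ! i))"
    unfolding 1 unfolding 2 by (simp add: 3)
  also have "w (ws ! i) (ws ! j) = ws"
    unfolding w_def by simp
  finally show ?thesis
    unfolding w_def by (simp add: eq_neg_iff_add_eq_0 add.commute)
qed

text \<open>A permutation is a product of transpositions, each of which changes \<open>g\<close>
  only by a sign. Since only vanishing is carried along, no signature has to be tracked.\<close>

lemma alternating_form_permute_zero:
  assumes g: "alternating_form k g" and p: "p permutes {..<k}" and "length ws = k" "g ws = 0"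
  shows "g (permute_list p ws) = 0"
  using finite_lessThan p assms(3,4)
proof (induction p arbitrary: ws rule: permutes_rev_induct)
  case id
  then show ?case by simp
next
  case (swap i j p)
  have "permute_list (p \<circ> Transposition.transpose i j) ws =
      permute_list (Transposition.transpose i j) (permute_list p ws)"
    by (rule permute_list_compose) (use swap in \<open>auto intro: permutes_swap_id\<close>)
  also have "\<dots> = (permute_list p ws)[i := permute_list p ws ! j, j := permute_list p ws ! i]"
    using swap by (intro nth_equalityI)
      (auto simp: permute_list_def nth_list_update Transposition.transpose_def)
  finally have eq: "permute_list (p \<circ> Transposition.transpose i j) ws =
      (permute_list p ws)[i := permute_list p ws ! j, j := permute_list p ws ! i]" .
  show ?case
    unfolding eq using alternating_form_swap[OF g, of "permute_list p ws" i j] swap by simp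
qed

text \<open>Laplace expansion along column \<open>j\<close>. The cofactors omit that column, so they
  can be taken from the unchanged matrix \<open>M\<close>, and linearity in \<open>x\<close> becomes
  visible.\<close>

lemma pluecker_list_update:
  fixes ws :: "('k::field ^ 'n) list"
  assumes "length s = length ws" "j < length ws"
  defines "M \<equiv> Matrix.mat (length ws) (length ws) (\<lambda>(i, j). vec_nth (ws ! j) (s ! i))"
  shows "pluecker (ws[j := x]) s = (\<Sum>i<length ws. vec_nth x (s ! i) * Determinant.cofactor M i j)"
proof -
  define M' where
    "M' = Matrix.mat (length ws) (length ws) (\<lambda>(i, l). vec_nth (ws[j := x] ! l) (s ! i))"
  have del: "mat_delete M' i j = mat_delete M i j" for i
    unfolding mat_delete_def M'_def M_def by (rule eq_matI) auto
  have "pluecker (ws[j := x]) s = Determinant.det M'"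
    using assms by (simp add: pluecker_def M'_def)
  also have "\<dots> = (\<Sum>i<length ws. M' $$ (i, j) * Determinant.cofactor M' i j)"
    by (rule laplace_expansion_column) (use assms in \<open>auto simp: M'_def\<close>)
  finally show ?thesis
    unfolding Determinant.cofactor_def del using assms by (simp add: M'_def)
qed

lemma pluecker_eq_entries:
  assumes "i < length ws" "j < length ws" "i \<noteq> j" "ws ! i = ws ! j"
  shows "pluecker ws s = 0"
proof -
  let ?M = "Matrix.mat (length ws) (length ws) (\<lambda>(i, j). vec_nth (ws ! j) (s ! i))"
  have "Determinant.det ?M = 0"
    by (rule det_identical_columns[of _ "length ws" i j])
      (use assms in \<open>auto intro!: eq_vecI\<close>)
  then show ?thesis
    by (simp add: pluecker_def)
qed

text \<open>The lists \<open>us\<close>, \<open>vs\<close> and the linear map \<phi> serve to treat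
  one block of columns inside a larger determinant, or all columns after a common linear
  map.\<close>

lemma alternating_form_pluecker:
  fixes \<phi> :: "'k::field ^ 'n \<Rightarrow> 'k ^ 'm"
  assumes "\<And>x y. \<phi> (x + y) = \<phi> x + \<phi> y" "\<And>c x. \<phi> (c *s x) = c *s \<phi> x"
  shows "alternating_form k (\<lambda>ws. pluecker (us @ map \<phi> ws @ vs) s)"
proof -
  have upd: "us @ map \<phi> (ws[i := x]) @ vs = (us @ map \<phi> ws @ vs)[length us + i := \<phi> x]"
    if "i < length ws" for ws i x
    using that by (simp add: list_update_append map_update)
  have "pluecker (us @ map \<phi> (ws[i := x + y]) @ vs) s =
      pluecker (us @ map \<phi> (ws[i := x]) @ vs) s + pluecker (us @ map \<phi> (ws[i := y]) @ vs) s"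
    "pluecker (us @ map \<phi> (ws[i := c *s x]) @ vs) s = c * pluecker (us @ map \<phi> (ws[i := x]) @ vs) s"
    if "i < length ws" for ws i x y c
  proof -
    show "pluecker (us @ map \<phi> (ws[i := x + y]) @ vs) s =
        pluecker (us @ map \<phi> (ws[i := x]) @ vs) s + pluecker (us @ map \<phi> (ws[i := y]) @ vs) s"
    proof (cases "length s = length (us @ map \<phi> ws @ vs)")
      case True
      with that show ?thesis
        unfolding upd[OF that] by (subst (1 2 3) pluecker_list_update)
          (auto simp: assms algebra_simps sum.distrib)
    next
      case False
      then show ?thesis
        by (auto simp: pluecker_def)
    qed
    show "pluecker (us @ map \<phi> (ws[i := c *s x]) @ vs) s = c * pluecker (us @ map \<phi> (ws[i := x]) @ vs) s"
    proof (cases "length s = length (us @ map \<phi> ws @ vs)")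
      case True
      with that show ?thesis
        unfolding upd[OF that] by (subst (1 2) pluecker_list_update)
          (auto simp: assms algebra_simps sum_distrib_left)
    next
      case False
      then show ?thesis
        by (auto simp: pluecker_def)
    qed
  qed
  moreover have "pluecker (us @ map \<phi> ws @ vs) s = 0"
    if "i < length ws" "j < length ws" "i \<noteq> j" "ws ! i = ws ! j" for ws i j
    by (rule pluecker_eq_entries[of "length us + i" _ "length us + j"])
      (use that in \<open>auto simp: nth_append\<close>)
  ultimately show ?thesis
    unfolding alternating_form_def by blast
qed

text \<open>One tuple for each \<open>k\<close>-element set of rows: with no order on the index type at hand, this
  replaces the increasing tuples.\<close>

definition subset_tuples :: "nat \<Rightarrow> 'n::finite list set" where
  "subset_tuples k = (\<lambda>S. SOME s. distinct s \<and> set s = S) ` {S. card S = k}"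

section \<open>Chosen row tuples, duality with basis vectors, and expansion of alternating
  forms\<close>

lemma some_tuple: "distinct (SOME s. distinct s \<and> set s = S) \<and> set (SOME s. distinct s \<and> set s = S) = S"
  for S :: "'n::finite set"
  by (rule someI_ex) (use finite_distinct_list[of S] in auto)

lemma subset_tuplesD:
  assumes "s \<in> subset_tuples k"
  shows "distinct s" "length s = k"
proof -
  obtain S where S: "card S = k" "s = (SOME s. distinct s \<and> set s = S)"
    using assms unfolding subset_tuples_def by blast
  then show "distinct s" "length s = k"
    using some_tuple[of S] distinct_card[of s] by auto
qed

lemma subset_tuples_ex: "card S = k \<Longrightarrow> \<exists>s\<in>subset_tuples k. set s = S"
  unfolding subset_tuples_def using some_tuple[of S] by (intro bexI[OF _ imageI]) auto

lemma subset_tuples_inject: "s \<in> subset_tuples k \<Longrightarrow> t \<in> subset_tuples k \<Longrightarrow> set s = set t \<Longrightarrow> s = t"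
proof -
  assume s: "s \<in> subset_tuples k" and t: "t \<in> subset_tuples k" and eq: "set s = set t"
  have "u = (SOME v. distinct v \<and> set v = set u)" if u: "u \<in> subset_tuples k" for u :: "'a list"
  proof -
    obtain S where "u = (SOME v. distinct v \<and> set v = S)"
      using u unfolding subset_tuples_def by blast
    then show ?thesis
      using some_tuple[of S] by simp
  qed
  from this[OF s] this[OF t] show "s = t"
    unfolding eq by simp
qed

lemma finite_subset_tuples: "finite (subset_tuples k)"
  unfolding subset_tuples_def by simp

text \<open>Duality: for distinct tuples some entry of \<open>t\<close> is missing from
  \<open>s\<close>, and the column of that basis vector is zero on the rows
  \<open>s\<close>.\<close>

lemma pluecker_axis:
  fixes s t :: "'n::finite list"
  assumes "s \<in> subset_tuples k" "t \<in> subset_tuples k"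
  shows "pluecker (map (\<lambda>i. axis i (1 :: 'k::field)) t) s = (if s = t then 1 else 0)"
proof (cases "s = t")
  case True
  have "Matrix.mat k k (\<lambda>(i, j). vec_nth (map (\<lambda>i. axis i (1 :: 'k)) t ! j) (t ! i)) = 1\<^sub>m k"
    by (rule eq_matI) (use subset_tuplesD[OF assms(2)] in \<open>auto simp: axis_def nth_eq_iff_index_eq\<close>)
  then show ?thesis
    using True subset_tuplesD[OF assms(2)] by (simp add: pluecker_def)
next
  case False
  note D = subset_tuplesD[OF assms(1)] subset_tuplesD[OF assms(2)]
  have "\<not> set t \<subseteq> set s"
  proof
    assume "set t \<subseteq> set s"
    then have "set t = set s"
      by (rule card_subset_eq[OF finite_set]) (use D distinct_card[of s] distinct_card[of t] in simp)
    then show False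
      using False subset_tuples_inject[OF assms] by simp
  qed
  then obtain j where j: "j < k" "t ! j \<notin> set s"
    using D by (metis in_set_conv_nth subsetI)
  have zero: "vec_nth (axis (t ! j) (1 :: 'k)) (s ! i) = 0" if "i < k" for i
  proof -
    have "s ! i \<noteq> t ! j"
      using j D that by (metis nth_mem)
    then show ?thesis
      by (simp add: axis_def)
  qed
  let ?ws = "map (\<lambda>i. axis i (1 :: 'k)) t"
  \<comment> \<open>Writing the list as an update by its own entry makes the expansion along the
    zero column \<open>j\<close> applicable.\<close>
  have "pluecker (?ws[j := ?ws ! j]) s = 0"
    by (subst pluecker_list_update) (use j D zero in \<open>auto intro!: sum.neutral\<close>)
  then show ?thesis using False by simp
qed

text \<open>Multilinearity reduces to tuples of basis vectors; alternation reduces these to distinct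
  tuples and, up to permutation, to the chosen ones.\<close>

lemma alternating_form_zeroI:
  fixes h :: "('k::field ^ 'n) list \<Rightarrow> 'k"
  assumes h: "alternating_form k h"
    and zero: "\<And>s. s \<in> subset_tuples k \<Longrightarrow> h (map (\<lambda>i. axis i 1) s) = 0"
    and "length ws = k"
  shows "h ws = 0"
proof -
  have axis: "h (map (\<lambda>i. axis i 1) t) = 0" if t: "length t = k" for t
  proof (cases "distinct t")
    case True
    then obtain s where s: "s \<in> subset_tuples k" "set s = set t"
      using subset_tuples_ex[of "set t" k] t distinct_card by metis
    then have "mset t = mset s"
      using True subset_tuplesD(1) by (metis set_eq_iff_mset_eq_distinct)
    then obtain p where p: "p permutes {..<length s}" "permute_list p s = t"
      by (rule mset_eq_permutation)
    have "h (permute_list p (map (\<lambda>i. axis i 1) s)) = 0"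
      by (rule alternating_form_permute_zero[OF h]) (use p s t zero subset_tuplesD in auto)
    then show ?thesis
      using p by (simp add: permute_list_map)
  next
    case False
    then obtain i j where "i < k" "j < k" "i \<noteq> j" "t ! i = t ! j"
      using t unfolding distinct_conv_nth by blast
    then show ?thesis
      by (intro alternating_form_eq[OF h, of _ i j]) (use t in auto)
  qed
  \<comment> \<open>Basis vectors are replaced by entries of \<open>ws\<close> from left to right.
    The tail \<open>t\<close> stays arbitrary, because entry \<open>i\<close> is expanded in basis
    vectors and the induction hypothesis is used at every \<open>r # t\<close>.\<close>
  have "h (take i ws @ map (\<lambda>i. axis i 1) t) = 0" if "i \<le> k" "length t = k - i" for i t
    using that
  proof (induction i arbitrary: t)
    case 0
    then show ?case using axis by simp
  next
    case (Suc i)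
    define us where "us = take (Suc i) ws @ map (\<lambda>i. axis i (1 :: 'k)) t"
    have us: "length us = k"
      using Suc.prems assms(3) unfolding us_def by simp
    have upd: "us[i := v] = take i ws @ v # map (\<lambda>i. axis i 1) t" for v
      using Suc.prems assms(3) unfolding us_def
      by (simp add: take_Suc_conv_app_nth list_update_append)
    have ax: "h (us[i := axis r 1]) = 0" for r
      using Suc.IH[of "r # t"] Suc.prems unfolding upd by simp
    have lin: "h (us[i := \<Sum>r\<in>S. vec_nth v r *s axis r 1]) = 0" if "finite S" for S v
      using that
    proof (induction S)
      case empty
      have "h (us[i := 0 *s 0]) = 0 * h (us[i := 0])"
        by (rule alternating_form_scale[OF h us]) (use Suc.prems in simp)
      then show ?case by simp
    next
      case (insert r S)
      then show ?case
        using alternating_form_add[OF h us] alternating_form_scale[OF h us] Suc.prems ax by simp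
    qed
    have "h (us[i := us ! i]) = 0"
      using lin[of UNIV "us ! i"] by (simp add: basis_expansion)
    then show ?case
      unfolding us_def by simp
  qed
  from this[of k "[]"] show ?thesis
    using assms(3) by simp
qed

text \<open>By \<open>pluecker_axis\<close> both sides agree on the chosen basis tuples, so
  \<open>alternating_form_zeroI\<close> applies to their difference.\<close>

lemma alternating_form_expansion:
  fixes g :: "('k::field ^ 'n) list \<Rightarrow> 'k"
  assumes g: "alternating_form k g" and ws: "length ws = k"
  shows "g ws = (\<Sum>s\<in>subset_tuples k. g (map (\<lambda>i. axis i 1) s) * pluecker ws s)"
proof -
  define h where
    "h ws = g ws - (\<Sum>s\<in>subset_tuples k. g (map (\<lambda>i. axis i 1) s) * pluecker ws s)" for ws
  have "alternating_form k (\<lambda>ws :: ('k ^ 'n) list. pluecker ws s)" for s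
    using alternating_form_pluecker[of "\<lambda>x. x :: 'k ^ 'n" k "[]" "[]" s] by simp
  then have "alternating_form k h"
    unfolding h_def by (intro alternating_form_diff alternating_form_sum g)
  moreover have "h (map (\<lambda>i. axis i 1) t) = 0" if "t \<in> subset_tuples k" for t
  proof -
    have "(\<Sum>s\<in>subset_tuples k. g (map (\<lambda>i. axis i 1) s) * pluecker (map (\<lambda>i. axis i 1) t) s) =
        (\<Sum>s\<in>subset_tuples k. if s = t then g (map (\<lambda>i. axis i 1) t) else 0)"
      by (rule sum.cong) (use that in \<open>auto simp: pluecker_axis\<close>)
    then show ?thesis
      unfolding h_def using that by (simp add: finite_subset_tuples)
  qed
  ultimately have "h ws = 0"
    by (rule alternating_form_zeroI) (use ws in auto)
  then show ?thesis
    unfolding h_def by simp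
qed


section \<open>Linear combinations of lists\<close>

text \<open>Coefficients belong to positions, not to vectors, because columns of an incidence matrix
  may coincide.\<close>

definition lincomb :: "'k::field list \<Rightarrow> ('k ^ 'n) list \<Rightarrow> 'k ^ 'n" where
  "lincomb cs ws = (\<Sum>(c, w)\<leftarrow>zip cs ws. c *s w)"

lemma lincomb_append:
  "length cs = length ws \<Longrightarrow> lincomb (cs @ ds) (ws @ vs) = lincomb cs ws + lincomb ds vs"
  by (simp add: lincomb_def)

lemma lincomb_nth:
  "length cs = length ws \<Longrightarrow> lincomb cs ws = (\<Sum>j<length ws. cs ! j *s ws ! j)"
  by (simp add: lincomb_def sum_list_sum_nth atLeast0LessThan)

lemma lincomb_map:
  assumes "\<And>x y. \<phi> (x + y) = \<phi> x + \<phi> y" "\<And>c x. \<phi> (c *s x) = c *s \<phi> x"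
  shows "lincomb cs (map \<phi> ws) = \<phi> (lincomb cs ws)"
proof -
  have "\<phi> 0 = 0"
    using assms(2)[of 0 0] by simp
  then show ?thesis
    by (induction cs ws rule: list_induct2') (simp_all add: lincomb_def assms)
qed

lemma lincomb_zero: "set cs \<subseteq> {0} \<Longrightarrow> lincomb cs ws = 0"
  by (induction cs ws rule: list_induct2') (auto simp: lincomb_def)

lemma is_basis_lincombE:
  assumes "is_basis ws W" "w \<in> W"
  obtains cs where "length cs = length ws" "lincomb cs ws = w"
proof -
  obtain u where u: "w = (\<Sum>v\<in>set ws. u v *s v)"
    using assms unfolding is_basis_def by (auto simp: vec.span_finite)
  have "lincomb (map u ws) ws = w"
    using assms unfolding u is_basis_def lincomb_def
    by (simp add: zip_map1 zip_same_conv_map comp_def case_prod_beta sum_list_distinct_conv_sum_set)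
  then show ?thesis
    by (rule that[rotated]) simp
qed

lemma lincomb_in_is_basis:
  assumes "is_basis ws W" "length cs = length ws"
  shows "lincomb cs ws \<in> W"
proof -
  have "lincomb cs ws \<in> vec.span (set ws)"
    unfolding lincomb_nth[OF assms(2)] by (intro vec.span_sum vec.span_scale vec.span_base) simp
  then show ?thesis
    using assms(1) unfolding is_basis_def by simp
qed

lemma lincomb_eq_0_is_basis:
  assumes "is_basis ws W" "length cs = length ws" "lincomb cs ws = 0"
  shows "set cs \<subseteq> {0}"
proof -
  let ?I = "{..<length ws}"
  have inj: "bij_betw ((!) ws) ?I (set ws)"
    by (rule bij_betw_nth) (use assms in \<open>auto simp: is_basis_def\<close>)
  define u where "u v = cs ! inv_into ?I ((!) ws) v" for v
  have u: "u (ws ! j) = cs ! j" if "j < length ws" for j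
    unfolding u_def using inj that by (simp add: bij_betw_def inv_into_f_f)
  have "(\<Sum>v\<in>set ws. u v *s v) = (\<Sum>j\<in>?I. u (ws ! j) *s ws ! j)"
    by (rule sum.reindex_bij_betw[OF inj, symmetric])
  also have "\<dots> = 0"
    using assms(2,3) by (simp add: lincomb_nth u)
  finally have "(\<Sum>v\<in>set ws. u v *s v) = 0" .
  then have "u v = 0" if "v \<in> set ws" for v
    using assms(1) that unfolding is_basis_def by (auto simp: vec.dependent_finite)
  then have "cs ! j = 0" if "j < length ws" for j
    using u[OF that] that by (metis nth_mem)
  then show ?thesis
    using assms(2) by (auto simp: in_set_conv_nth)
qed

text \<open>As \<open>s\<close> lists every row once, the coordinate is the determinant of a square
  matrix; it vanishes iff there is a nonzero kernel vector, read here as a list of column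
  coefficients.\<close>

lemma pluecker_eq_0_iff:
  fixes us :: "('k::field ^ 'n) list"
  assumes "distinct s" "set s = UNIV" "length us = CARD('n)"
  shows "pluecker us s = 0 \<longleftrightarrow> (\<exists>cs. length cs = length us \<and> \<not> set cs \<subseteq> {0} \<and> lincomb cs us = 0)"
proof -
  define N where "N = CARD('n)"
  define M where "M = Matrix.mat N N (\<lambda>(i, j). vec_nth (us ! j) (s ! i))"
  have s: "length s = N"
    using assms distinct_card unfolding N_def by metis
  have mult: "M *\<^sub>v v = 0\<^sub>v N \<longleftrightarrow> lincomb (list_of_vec v) us = 0" if "v \<in> carrier_vec N" for v
  proof -
    have "vec_index (M *\<^sub>v v) i = vec_nth (lincomb (list_of_vec v) us) (s ! i)" if "i < N" for i
      using that \<open>v \<in> carrier_vec N\<close> assms(3)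
      by (simp add: M_def N_def scalar_prod_def lincomb_nth atLeast0LessThan mult.commute list_of_vec_index)
    then have "M *\<^sub>v v = 0\<^sub>v N \<longleftrightarrow> (\<forall>i<N. vec_nth (lincomb (list_of_vec v) us) (s ! i) = 0)"
      unfolding Matrix.vec_eq_iff by (simp add: M_def)
    also have "\<dots> \<longleftrightarrow> lincomb (list_of_vec v) us = 0"
      unfolding Finite_Cartesian_Product.vec_eq_iff using assms(2) s
      by (metis UNIV_I in_set_conv_nth zero_index)
    finally show ?thesis .
  qed
  have "pluecker us s = Determinant.det M"
    using assms s by (simp add: pluecker_def M_def N_def)
  also have "\<dots> = 0 \<longleftrightarrow> (\<exists>v. v \<in> carrier_vec N \<and> v \<noteq> 0\<^sub>v N \<and> M *\<^sub>v v = 0\<^sub>v N)"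
    by (rule det_0_iff_vec_prod_zero) (simp add: M_def)
  also have "\<dots> \<longleftrightarrow> (\<exists>cs. length cs = N \<and> \<not> set cs \<subseteq> {0} \<and> lincomb cs us = 0)" (is "?L = ?R")
  proof
    assume ?L
    then obtain v where v: "v \<in> carrier_vec N" "v \<noteq> 0\<^sub>v N" "M *\<^sub>v v = 0\<^sub>v N" by blast
    have "\<not> set (list_of_vec v) \<subseteq> {0}"
    proof
      assume "set (list_of_vec v) \<subseteq> {0}"
      then have "v = 0\<^sub>v N"
        using v(1) by (intro eq_vecI) (auto simp: set_list_of_vec subset_iff vec_set_def)
      with v show False by blast
    qed
    then show ?R
      using v mult[OF v(1)] by (intro exI[of _ "list_of_vec v"]) auto
  next
    assume ?R
    then obtain cs where cs: "length cs = N" "\<not> set cs \<subseteq> {0}" "lincomb cs us = 0" by blast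
    have "vec_of_list cs \<noteq> 0\<^sub>v N"
    proof
      assume "vec_of_list cs = 0\<^sub>v N"
      then have "cs ! i = 0" if "i < N" for i
        using that by (metis vec_of_list_index index_zero_vec(1))
      then show False
        using cs by (auto simp: in_set_conv_nth)
    qed
    then show ?L
      using cs mult[of "vec_of_list cs"] by (intro exI[of _ "vec_of_list cs"])
        (auto simp: list_vec carrier_vecI)
  qed
  finally show ?thesis
    using assms unfolding N_def by simp
qed


section \<open>The incidence determinant\<close>

text \<open>The pair (\<open>v\<close>, \<open>w\<close>) in the direct sum of two copies of the
  space, indexed by a sum type so that Pluecker coordinates apply to it.\<close>

definition stack :: "'k ^ 'n \<Rightarrow> 'k ^ 'n \<Rightarrow> 'k ^ ('n + 'n)" where
  "stack v w = (\<chi> r. case r of Inl i \<Rightarrow> vec_nth v i | Inr i \<Rightarrow> vec_nth w i)"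

lemma stack_add: "stack v w + stack v' w' = stack (v + v') (w + w')"
  by (simp add: stack_def Finite_Cartesian_Product.vec_eq_iff split: sum.split)

lemma stack_scale: "c *s stack v w = stack (c *s v) (c *s w)"
  by (simp add: stack_def Finite_Cartesian_Product.vec_eq_iff split: sum.split)

lemma stack_eq_iff: "stack v w = stack v' w' \<longleftrightarrow> v = v' \<and> w = w'"
  unfolding stack_def Finite_Cartesian_Product.vec_eq_iff split_sum_all by simp

lemma stack_0: "stack 0 0 = 0"
  by (simp add: stack_def Finite_Cartesian_Product.vec_eq_iff split: sum.split)

definition all_rows :: "'n::finite list" where
  "all_rows = (SOME s. distinct s \<and> set s = UNIV)"

text \<open>In top degree the expansion of an alternating form thus has a single term: all such
  forms are multiples of one determinant.\<close>

lemma subset_tuples_card: "subset_tuples CARD('n) = {all_rows :: 'n::finite list}"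
proof -
  have "{S. card S = CARD('n)} = {UNIV :: 'n set}"
    using card_subset_eq[OF finite subset_UNIV] by auto
  then show ?thesis
    unfolding subset_tuples_def all_rows_def by simp
qed

text \<open>If the columns span \<open>A\<close>, \<open>C\<close>, \<open>B\<close>, \<open>D\<close> and \<open>B + D\<close> is the whole space, then this determinant
  tests whether \<open>A\<close>, \<open>C\<close> and \<open>B \<inter> D\<close> are in direct sum, without choosing a basis of \<open>B \<inter> D\<close>.\<close>

definition incidence_columns ::
  "('k::field ^ 'n) list \<Rightarrow> ('k ^ 'n) list \<Rightarrow> ('k ^ 'n) list \<Rightarrow> ('k ^ 'n) list \<Rightarrow> ('k ^ ('n + 'n)) list"
  where
  "incidence_columns As Cs Bs Ds =
    map (\<lambda>v. stack v 0) As @ map (\<lambda>v. stack v 0) Cs @ map (\<lambda>v. stack v v) Bs @ map (stack 0) Ds"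

definition incidence_det ::
  "('k::field ^ 'n) list \<Rightarrow> ('k ^ 'n) list \<Rightarrow> ('k ^ 'n) list \<Rightarrow> ('k ^ 'n) list \<Rightarrow> 'k" where
  "incidence_det As Cs Bs Ds = pluecker (incidence_columns As Cs Bs Ds) all_rows"

lemma lincomb_incidence_columns:
  assumes "length as = length As" "length cs = length Cs" "length bs = length Bs" "length ds = length Ds"
  shows "lincomb (as @ cs @ bs @ ds) (incidence_columns As Cs Bs Ds) =
    stack (lincomb as As + lincomb cs Cs + lincomb bs Bs) (lincomb bs Bs + lincomb ds Ds)"
proof -
  have "lincomb as (map (\<lambda>v. stack v 0) As) = stack (lincomb as As) 0"
    "lincomb cs (map (\<lambda>v. stack v 0) Cs) = stack (lincomb cs Cs) 0"
    "lincomb bs (map (\<lambda>v. stack v v) Bs) = stack (lincomb bs Bs) (lincomb bs Bs)"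
    "lincomb ds (map (stack 0) Ds) = stack 0 (lincomb ds Ds)"
    by (rule lincomb_map; simp add: stack_add stack_scale)+
  then show ?thesis
    using assms unfolding incidence_columns_def
    by (simp add: lincomb_append stack_add add.assoc)
qed

text \<open>A vanishing combination of the columns amounts to x + v + u = 0 and u + w = 0 with x, v,
  u, w in \<open>A\<close>, \<open>C\<close>, \<open>B\<close>, \<open>D\<close>. So u lies in
  \<open>B\<close> \<inter> \<open>D\<close> and x + u in \<open>C\<close>. The length hypothesis
  makes the matrix square.\<close>

lemma incidence_det_eq_0_iff:
  fixes As Bs Cs Ds :: "('k::field ^ 'n) list"
  assumes A: "is_basis As A" and C: "is_basis Cs C" and B: "is_basis Bs B" and D: "is_basis Ds D"
    and len: "length As + length Cs + length Bs + length Ds = 2 * CARD('n)"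
  shows "incidence_det As Cs Bs Ds = 0 \<longleftrightarrow> (\<exists>x\<in>A. \<exists>u\<in>B \<inter> D. x + u \<in> C \<and> (x \<noteq> 0 \<or> u \<noteq> 0))"
proof -
  let ?cols = "incidence_columns As Cs Bs Ds"
  have "distinct (all_rows :: ('n + 'n) list)" "set (all_rows :: ('n + 'n) list) = UNIV"
    using some_tuple[of "UNIV :: ('n + 'n) set"] unfolding all_rows_def by auto
  moreover have "length ?cols = CARD('n + 'n)"
    using len by (simp add: incidence_columns_def)
  ultimately have *: "incidence_det As Cs Bs Ds = 0 \<longleftrightarrow>
      (\<exists>es. length es = length ?cols \<and> \<not> set es \<subseteq> {0} \<and> lincomb es ?cols = 0)"
    unfolding incidence_det_def by (rule pluecker_eq_0_iff)
  have neg: "vec.subspace C" "vec.subspace D"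
    using C D unfolding is_basis_def by (metis vec.subspace_span)+
  show ?thesis
    unfolding *
  proof
    assume "\<exists>es. length es = length ?cols \<and> \<not> set es \<subseteq> {0} \<and> lincomb es ?cols = 0"
    then obtain es where es: "length es = length ?cols" "\<not> set es \<subseteq> {0}" "lincomb es ?cols = 0"
      by blast
    define as where "as = take (length As) es"
    define cs where "cs = take (length Cs) (drop (length As) es)"
    define bs where "bs = take (length Bs) (drop (length Cs) (drop (length As) es))"
    define ds where "ds = drop (length Bs) (drop (length Cs) (drop (length As) es))"
    have es_eq: "es = as @ cs @ bs @ ds"
      unfolding as_def cs_def bs_def ds_def by (simp only: append_take_drop_id)
    have ln: "length as = length As" "length cs = length Cs" "length bs = length Bs" "length ds = length Ds"
      using es(1) unfolding as_def cs_def bs_def ds_def incidence_columns_def by auto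
    let ?x = "lincomb as As" and ?u = "lincomb bs Bs" and ?v = "lincomb cs Cs" and ?w = "lincomb ds Ds"
    have eqs: "?x + ?v + ?u = 0" "?u + ?w = 0"
      using es(3) unfolding es_eq lincomb_incidence_columns[OF ln] stack_0[symmetric] stack_eq_iff
      by auto
    have u: "?u = - ?w" and xu: "?x + ?u = - ?v"
      using eqs by (simp_all add: eq_neg_iff_add_eq_0 algebra_simps)
    \<comment> \<open>Otherwise all four combinations are zero, and independence of the four bases
      makes every coefficient zero.\<close>
    have "?x \<noteq> 0 \<or> ?u \<noteq> 0"
    proof (rule ccontr)
      assume "\<not> (?x \<noteq> 0 \<or> ?u \<noteq> 0)"
      then have "?x = 0" "?u = 0" "?v = 0" "?w = 0"
        using eqs by auto
      then have "set es \<subseteq> {0}"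
        using lincomb_eq_0_is_basis[OF A ln(1)] lincomb_eq_0_is_basis[OF C ln(2)]
          lincomb_eq_0_is_basis[OF B ln(3)] lincomb_eq_0_is_basis[OF D ln(4)]
        unfolding es_eq by auto
      with es(2) show False ..
    qed
    moreover have "?u \<in> D"
      unfolding u using lincomb_in_is_basis[OF D ln(4)] neg by (simp add: vec.subspace_neg)
    moreover have "?x + ?u \<in> C"
      unfolding xu using lincomb_in_is_basis[OF C ln(2)] neg by (simp add: vec.subspace_neg)
    ultimately show "\<exists>x\<in>A. \<exists>u\<in>B \<inter> D. x + u \<in> C \<and> (x \<noteq> 0 \<or> u \<noteq> 0)"
      using lincomb_in_is_basis[OF A ln(1)] lincomb_in_is_basis[OF B ln(3)] by blast
  next
    assume "\<exists>x\<in>A. \<exists>u\<in>B \<inter> D. x + u \<in> C \<and> (x \<noteq> 0 \<or> u \<noteq> 0)"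
    then obtain x u where xu: "x \<in> A" "u \<in> B" "u \<in> D" "x + u \<in> C" "x \<noteq> 0 \<or> u \<noteq> 0" by blast
    obtain as where as: "length as = length As" "lincomb as As = x"
      using is_basis_lincombE[OF A xu(1)] .
    obtain bs where bs: "length bs = length Bs" "lincomb bs Bs = u"
      using is_basis_lincombE[OF B xu(2)] .
    obtain cs where cs: "length cs = length Cs" "lincomb cs Cs = - (x + u)"
      using is_basis_lincombE[OF C vec.subspace_neg[OF neg(1) xu(4)]] .
    obtain ds where ds: "length ds = length Ds" "lincomb ds Ds = - u"
      using is_basis_lincombE[OF D vec.subspace_neg[OF neg(2) xu(3)]] .
    have "lincomb (as @ cs @ bs @ ds) ?cols = 0"
      unfolding lincomb_incidence_columns[OF as(1) cs(1) bs(1) ds(1)] as(2) bs(2) cs(2) ds(2)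
      by (simp add: stack_0)
    moreover have "\<not> set (as @ cs @ bs @ ds) \<subseteq> {0}"
      using xu(5) as(2) bs(2) lincomb_zero[of as As] lincomb_zero[of bs Bs] by auto
    ultimately show "\<exists>es. length es = length ?cols \<and> \<not> set es \<subseteq> {0} \<and> lincomb es ?cols = 0"
      using as bs cs ds by (intro exI[of _ "as @ cs @ bs @ ds"]) (simp add: incidence_columns_def)
  qed
qed

text \<open>The factor depends on \<open>A\<close> only and is therefore common to all four brackets
  of the cross ratio. The proof takes the determinant of \<open>A\<close> acting on both copies of
  the space, that is, the square of the determinant of \<open>A\<close>.\<close>

lemma incidence_det_equivariant:
  fixes A :: "'k::field ^ 'n ^ 'n"
  obtains c where "\<And>As Bs Cs Ds. length As + length Cs + length Bs + length Ds = 2 * CARD('n) \<Longrightarrow>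
    incidence_det (map ((*v) A) As) (map ((*v) A) Cs) (map ((*v) A) Bs) (map ((*v) A) Ds) =
    c * incidence_det As Cs Bs Ds"
proof -
  define G where
    "G u = stack (A *v (\<chi> i. vec_nth u (Inl i))) (A *v (\<chi> i. vec_nth u (Inr i)))" for u :: "'k ^ ('n + 'n)"
  have G: "G (stack v w) = stack (A *v v) (A *v w)" for v w
    unfolding G_def stack_def by simp
  have "G (x + y) = G x + G y" for x y
  proof -
    have "(\<chi> i. vec_nth (x + y) (f i)) = (\<chi> i. vec_nth x (f i)) + (\<chi> i. vec_nth y (f i))"
      for f :: "'n \<Rightarrow> 'n + 'n"
      by (simp add: Finite_Cartesian_Product.vec_eq_iff)
    then show ?thesis
      unfolding G_def by (simp add: matrix_vector_right_distrib stack_add)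
  qed
  moreover have "G (c *s x) = c *s G x" for c x
  proof -
    have "(\<chi> i. vec_nth (c *s x) (f i)) = c *s (\<chi> i. vec_nth x (f i))" for f :: "'n \<Rightarrow> 'n + 'n"
      by (simp add: Finite_Cartesian_Product.vec_eq_iff)
    then show ?thesis
      unfolding G_def by (simp add: vector_scalar_commute stack_scale)
  qed
  ultimately have alt: "alternating_form CARD('n + 'n) (\<lambda>us. pluecker (map G us) all_rows)"
    using alternating_form_pluecker[of G "CARD('n + 'n)" "[]" "[]"] by simp
  have 0: "A *v 0 = 0"
    by (simp add: Finite_Cartesian_Product.vec_eq_iff matrix_vector_mult_def)
  have map_G: "map G (incidence_columns As Cs Bs Ds) =
      incidence_columns (map ((*v) A) As) (map ((*v) A) Cs) (map ((*v) A) Bs) (map ((*v) A) Ds)"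
    for As Bs Cs Ds :: "('k ^ 'n) list"
    by (simp add: incidence_columns_def G 0)
  show ?thesis
  proof (rule that)
    fix As Bs Cs Ds :: "('k ^ 'n) list"
    assume "length As + length Cs + length Bs + length Ds = 2 * CARD('n)"
    then have "length (incidence_columns As Cs Bs Ds) = CARD('n + 'n)"
      by (simp add: incidence_columns_def)
    from alternating_form_expansion[OF alt this]
    show "incidence_det (map ((*v) A) As) (map ((*v) A) Cs) (map ((*v) A) Bs) (map ((*v) A) Ds) =
      pluecker (map G (map (\<lambda>i. axis i 1) all_rows)) all_rows * incidence_det As Cs Bs Ds"
      unfolding incidence_det_def map_G by (simp only: subset_tuples_card sum.insert_remove) simp
  qed
qed


section \<open>Multiforms\<close>

text \<open>The second assumption covers the empty sum: \<open>multihom.const\<close> gives the zero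
  polynomial in degree 0 only.\<close>

lemma multihom_sum:
  fixes f :: "'s \<Rightarrow> ('i \<Rightarrow> 'c \<Rightarrow> 'k::comm_ring_1) \<Rightarrow> 'k"
  assumes "finite S" "multihom d (\<lambda>_ :: 'i \<Rightarrow> 'c \<Rightarrow> 'k. 0)"
    "\<And>s. s \<in> S \<Longrightarrow> multihom d (f s)"
  shows "multihom d (\<lambda>p. \<Sum>s\<in>S. f s p)"
  using assms by (induction S rule: finite_induct) (auto intro: multihom.add)

lemma multihom_cmult:
  assumes "multihom d f"
  shows "multihom d (\<lambda>p. c * f p)"
  using multihom.mult[OF multihom.const assms, of c] by simp

definition unit_degree :: "'i \<Rightarrow> 'i \<Rightarrow> nat" where
  "unit_degree i j = (if j = i then 1 else 0)"

lemma multihom_var: "multihom (unit_degree i) (\<lambda>p. p i s)"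
  unfolding unit_degree_def by (rule multihom.var)

text \<open>The determinant is alternating in each of its four blocks of columns, so it can be
  expanded block by block. The coefficients are constants, which exhibits a polynomial linear in
  each of four systems of Pluecker coordinates.\<close>

lemma incidence_det_expansion:
  fixes As Bs Cs Ds :: "('k::field ^ 'n) list"
  shows "incidence_det As Cs Bs Ds =
    (\<Sum>a\<in>subset_tuples (length As). \<Sum>c\<in>subset_tuples (length Cs).
     \<Sum>b\<in>subset_tuples (length Bs). \<Sum>d\<in>subset_tuples (length Ds).
       incidence_det (map (\<lambda>i. axis i 1) a) (map (\<lambda>i. axis i 1) c)
         (map (\<lambda>i. axis i 1) b) (map (\<lambda>i. axis i 1) d) *
       (pluecker As a * (pluecker Cs c * (pluecker Bs b * pluecker Ds d))))"
proof -
  have A: "alternating_form k (\<lambda>As :: ('k ^ 'n) list. incidence_det As Cs Bs Ds)"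
    for k and Bs Cs Ds :: "('k ^ 'n) list"
    using alternating_form_pluecker[of "\<lambda>v :: 'k ^ 'n. stack v 0" k "[]"]
    by (simp add: incidence_det_def incidence_columns_def stack_add stack_scale)
  have C: "alternating_form k (\<lambda>Cs :: ('k ^ 'n) list. incidence_det As Cs Bs Ds)"
    for k and As Bs Ds :: "('k ^ 'n) list"
    unfolding incidence_det_def incidence_columns_def
    by (rule alternating_form_pluecker) (simp_all add: stack_add stack_scale)
  have B: "alternating_form k (\<lambda>Bs :: ('k ^ 'n) list. incidence_det As Cs Bs Ds)"
    for k and As Cs Ds :: "('k ^ 'n) list"
    unfolding incidence_det_def incidence_columns_def append_assoc[symmetric, of "map _ As"]
    by (rule alternating_form_pluecker) (simp_all add: stack_add stack_scale)
  have D: "alternating_form k (\<lambda>Ds :: ('k ^ 'n) list. incidence_det As Cs Bs Ds)"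
    for k and As Bs Cs :: "('k ^ 'n) list"
    using alternating_form_pluecker[of "stack 0 :: 'k ^ 'n \<Rightarrow> _" k _ "[]"]
    unfolding incidence_det_def incidence_columns_def append_assoc[symmetric]
    by (simp add: stack_add stack_scale del: append_assoc)
  show ?thesis
    apply (subst alternating_form_expansion[OF A refl])
    apply (subst alternating_form_expansion[OF C refl])
    apply (subst alternating_form_expansion[OF B refl])
    apply (subst alternating_form_expansion[OF D refl])
    apply (simp add: sum_distrib_right sum_distrib_left mult_ac)
    done
qed

text \<open>The lengths are fixed beforehand since they set the ranges of summation, and
  \<open>f\<close> has to be one polynomial for all points.\<close>

lemma incidence_det_multihom:
  obtains f :: "(nat \<Rightarrow> 'n::finite list \<Rightarrow> 'k::field) \<Rightarrow> 'k" where
    "multihom (\<lambda>j. unit_degree i\<^sub>A j + (unit_degree i\<^sub>C j + (unit_degree i\<^sub>B j + unit_degree i\<^sub>D j))) f"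
    "\<And>p As Cs Bs Ds. p i\<^sub>A = pluecker As \<Longrightarrow> p i\<^sub>C = pluecker Cs \<Longrightarrow> p i\<^sub>B = pluecker Bs \<Longrightarrow>
      p i\<^sub>D = pluecker Ds \<Longrightarrow> length As = k\<^sub>A \<Longrightarrow> length Cs = k\<^sub>C \<Longrightarrow> length Bs = k\<^sub>B \<Longrightarrow>
      length Ds = k\<^sub>D \<Longrightarrow> f p = incidence_det As Cs Bs Ds"
proof
  let ?d = "\<lambda>j. unit_degree i\<^sub>A j + (unit_degree i\<^sub>C j + (unit_degree i\<^sub>B j + unit_degree i\<^sub>D j))"
  let ?f = "\<lambda>p :: nat \<Rightarrow> 'n list \<Rightarrow> 'k. \<Sum>a\<in>subset_tuples k\<^sub>A. \<Sum>c\<in>subset_tuples k\<^sub>C. \<Sum>b\<in>subset_tuples k\<^sub>B. \<Sum>d\<in>subset_tuples k\<^sub>D.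
       incidence_det (map (\<lambda>i. axis i 1) a) (map (\<lambda>i. axis i 1) c)
         (map (\<lambda>i. axis i 1) b) (map (\<lambda>i. axis i (1 :: 'k)) d) *
       (p i\<^sub>A a * (p i\<^sub>C c * (p i\<^sub>B b * p i\<^sub>D d)))"
  have m: "multihom ?d (\<lambda>p :: nat \<Rightarrow> 'n list \<Rightarrow> 'k. p i\<^sub>A a * (p i\<^sub>C c * (p i\<^sub>B b * p i\<^sub>D d)))" for a b c d
    by (intro multihom.mult multihom_var)
  \<comment> \<open>Zero in the required degree arises as 0 times a monomial.\<close>
  have z: "multihom ?d (\<lambda>_ :: nat \<Rightarrow> 'n list \<Rightarrow> 'k. 0)"
    using multihom_cmult[OF m, of 0] by simp
  show "multihom ?d ?f"
    by (intro multihom_sum finite_subset_tuples z multihom_cmult m)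
  show "?f p = incidence_det As Cs Bs Ds"
    if "p i\<^sub>A = pluecker As" "p i\<^sub>C = pluecker Cs" "p i\<^sub>B = pluecker Bs" "p i\<^sub>D = pluecker Ds"
      "length As = k\<^sub>A" "length Cs = k\<^sub>C" "length Bs = k\<^sub>B" "length Ds = k\<^sub>D" for p As Cs Bs Ds
    unfolding incidence_det_expansion[of As Cs Bs Ds] that ..
qed


section \<open>Two configurations of flags\<close>

lemma subspace_of_dim:
  fixes W :: "('k::field ^ 'n) set"
  assumes "vec.subspace W" "k \<le> vec.dim W"
  obtains U where "vec.subspace U" "U \<subseteq> W" "vec.dim U = k"
proof -
  obtain B where B: "B \<subseteq> W" "vec.independent B" "card B = vec.dim W"
    by (metis vec.basis_exists)
  then obtain T where T: "T \<subseteq> B" "card T = k"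
    using assms(2) by (metis obtain_subset_with_card_n)
  show ?thesis
  proof (rule that)
    show "vec.subspace (vec.span T)" by (rule vec.subspace_span)
    show "vec.span T \<subseteq> W"
      using T B assms(1) by (intro vec.span_minimal) auto
    show "vec.dim (vec.span T) = k"
      using vec.dim_span_eq_card_independent[OF vec.independent_mono[OF B(2) T(1)]] T(2) by simp
  qed
qed

text \<open>The coordinates in \<open>S\<close> are linear functions of those outside.
  \<open>W\<close> is the image of the coordinate subspace \<open>V\<close> under \<phi>, which is
  injective as the identity minus a map of square zero: \<beta> leads from \<open>T\<close> out of
  \<open>S\<close>.\<close>

lemma graph_subspace:
  fixes \<beta> :: "'n::finite \<Rightarrow> 'n" and S T :: "'n set"
  assumes "T \<subseteq> S" "\<beta> ` T \<inter> S = {}"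
  defines "W \<equiv> {v :: 'k::field ^ 'n. \<forall>r\<in>S. vec_nth v r = (if r \<in> T then - vec_nth v (\<beta> r) else 0)}"
  shows "vec.subspace W" "vec.dim W = CARD('n) - card S"
proof -
  define \<phi> :: "'k ^ 'n \<Rightarrow> 'k ^ 'n"
    where "\<phi> v = (\<chi> r. vec_nth v r - (if r \<in> T then vec_nth v (\<beta> r) else 0))" for v
  define V where "V = {v :: 'k ^ 'n. \<forall>r. r \<notin> - S \<longrightarrow> vec_nth v r = 0}"
  have lin: "Vector_Spaces.linear (*s) (*s) \<phi>"
    by unfold_locales
      (auto simp: \<phi>_def Finite_Cartesian_Product.vec_eq_iff algebra_simps)
  have inj: "v = 0" if "\<phi> v = 0" for v
  proof -
    have eq: "vec_nth v r = (if r \<in> T then vec_nth v (\<beta> r) else 0)" for r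
      using that unfolding \<phi>_def Finite_Cartesian_Product.vec_eq_iff by simp
    have "vec_nth v r = 0" for r
    proof (cases "r \<in> T")
      case True
      then have "\<beta> r \<notin> T" using assms by blast
      then show ?thesis using eq[of r] eq[of "\<beta> r"] True by simp
    qed (use eq[of r] in simp)
    then show ?thesis by (simp add: Finite_Cartesian_Product.vec_eq_iff)
  qed
  have "vec.subspace V"
    unfolding V_def vec.subspace_def by simp
  have "W = \<phi> ` V"
  proof (intro equalityI subsetI)
    fix v assume v: "v \<in> W"
    define u where "u = (\<chi> r. if r \<in> S then 0 else vec_nth v r)"
    have "v = \<phi> u"
      unfolding Finite_Cartesian_Product.vec_eq_iff
    proof
      fix r
      show "vec_nth v r = vec_nth (\<phi> u) r"
        using v assms(1,2) unfolding W_def \<phi>_def u_def by (cases "r \<in> S") auto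
    qed
    moreover have "u \<in> V" unfolding u_def V_def by simp
    ultimately show "v \<in> \<phi> ` V" by blast
  next
    fix v assume "v \<in> \<phi> ` V"
    then obtain u where "v = \<phi> u" "u \<in> V" by blast
    then show "v \<in> W"
      using assms(1,2) unfolding W_def \<phi>_def V_def by auto
  qed
  moreover have "vec.dim (\<phi> ` V) = vec.dim V"
  proof (rule vec.dim_image_eq[OF lin], rule inj_onI)
    fix x y assume "\<phi> x = \<phi> y"
    moreover have "\<phi> (x - y) = \<phi> x - \<phi> y"
      by (simp add: \<phi>_def Finite_Cartesian_Product.vec_eq_iff)
    ultimately show "x = y"
      using inj[of "x - y"] by simp
  qed
  moreover have "vec.dim V = CARD('n) - card S"
    unfolding V_def dim_substandard_cart by (simp add: Compl_eq_Diff_UNIV card_Diff_subset)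
  ultimately show "vec.subspace W" "vec.dim W = CARD('n) - card S"
    using vec.linear_subspace_image[OF lin \<open>vec.subspace V\<close>] by auto
qed

text \<open>The sum map from \<open>A\<close> \<times> \<open>U\<close> to the quotient by
  \<open>C\<close> has a nonzero kernel. With complementary dimensions this is the vanishing of a
  bracket of the cross ratio.\<close>

definition meets :: "('k::field ^ 'n) set \<Rightarrow> ('k ^ 'n) set \<Rightarrow> ('k ^ 'n) set \<Rightarrow> bool" where
  "meets A C U \<longleftrightarrow> (\<exists>x\<in>A. \<exists>u\<in>U. x + u \<in> C \<and> (x \<noteq> 0 \<or> u \<noteq> 0))"

text \<open>The subspaces of the first two flags are spanned by the basis vectors with indices in
  \<open>IA\<close>, \<open>IB\<close>, \<open>IC\<close>. The third subspace of the third flag identifies \<open>A\<^sub>1\<close> with \<open>A\<^sub>2\<close> up to a plane,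
  and kills the part \<open>K\<close> common to \<open>B\<^sub>1 \<inter> C\<^sub>2\<close> and \<open>B\<^sub>2 \<inter> C\<^sub>1\<close>; in the remaining
  plane, the four lines coming from \<open>A\<^sub>1\<close>, \<open>A\<^sub>2\<close>, \<open>B\<^sub>1 \<inter> C\<^sub>2\<close> and \<open>B\<^sub>2 \<inter> C\<^sub>1\<close> coincide in pairs.
  The two ways of pairing them give the two values \<open>0\<close> and \<open>\<infinity>\<close> of the cross ratio.\<close>

lemma configurations:
  fixes a d :: nat and F :: "('k::field ^ 'n::finite) set list set"
  assumes ad: "0 < a" "0 < d" and n: "2 * a + 3 * d + 1 \<le> CARD('n)"
  defines "F \<equiv> flag_variety [a, a + 2 * d, CARD('n) - (a + d)]"
  obtains A\<^sub>1 B\<^sub>1 C\<^sub>1 A\<^sub>2 B\<^sub>2 C\<^sub>2 C\<^sub>3 C\<^sub>3' :: "('k ^ 'n) set"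
  where "[A\<^sub>1, B\<^sub>1, C\<^sub>1] \<in> F" "[A\<^sub>2, B\<^sub>2, C\<^sub>2] \<in> F"
    "vec.subspace C\<^sub>3" "vec.dim C\<^sub>3 = CARD('n) - (a + d)"
    "vec.subspace C\<^sub>3'" "vec.dim C\<^sub>3' = CARD('n) - (a + d)"
    "meets A\<^sub>1 C\<^sub>3 (B\<^sub>1 \<inter> C\<^sub>2)" "\<not> meets A\<^sub>1 C\<^sub>3 (B\<^sub>2 \<inter> C\<^sub>1)" "\<not> meets A\<^sub>2 C\<^sub>3 (B\<^sub>1 \<inter> C\<^sub>2)"
    "meets A\<^sub>1 C\<^sub>3' (B\<^sub>2 \<inter> C\<^sub>1)" "\<not> meets A\<^sub>1 C\<^sub>3' (B\<^sub>1 \<inter> C\<^sub>2)" "\<not> meets A\<^sub>2 C\<^sub>3' (B\<^sub>2 \<inter> C\<^sub>1)"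
proof -
  define n where "n = CARD('n)"
  \<comment> \<open>The index type has no numbering of its own; \<open>e\<close> supplies
    one.\<close>
  obtain e where e: "bij_betw e {..<n} (UNIV :: 'n set)"
    using ex_bij_betw_nat_finite[OF finite[of "UNIV :: 'n set"]] unfolding n_def by (auto simp: atLeast0LessThan)
  have inj: "e i = e j \<longleftrightarrow> i = j" if "i < n" "j < n" for i j
    using e that unfolding bij_betw_def inj_on_def by blast
  have surj: "\<exists>i<n. r = e i" for r
    using e unfolding bij_betw_def by blast
  have e_in: "e i \<in> e ` I \<longleftrightarrow> i \<in> I" if "i < n" "I \<subseteq> {..<n}" for i I
    using inj that by blast
  have card_e: "card (e ` I) = card I" if "I \<subseteq> {..<n}" for I
    using e that unfolding bij_betw_def by (metis card_image inj_on_subset)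
  have all_e: "(\<forall>r. P r) \<longleftrightarrow> (\<forall>i<n. P (e i))" for P
    using surj by metis
  have eq0: "x = 0" if "\<And>i. i < n \<Longrightarrow> vec_nth x (e i) = 0" for x :: "'k ^ 'n"
    unfolding Finite_Cartesian_Product.vec_eq_iff all_e using that by simp

  \<comment> \<open>Coordinate subspaces\<close>
  define X where "X I = {x :: 'k ^ 'n. \<forall>i<n. i \<notin> I \<longrightarrow> vec_nth x (e i) = 0}" for I
  have X_sub: "vec.subspace (X I)" for I
    unfolding X_def vec.subspace_def by simp
  have X_dim: "vec.dim (X I) = card I" if "I \<subseteq> {..<n}" for I
  proof -
    have "X I = {x. \<forall>r. r \<notin> e ` I \<longrightarrow> vec_nth x r = 0}"
      unfolding X_def all_e using e_in[OF _ that] by auto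
    then show ?thesis
      using dim_substandard_cart[of "e ` I"] card_e[OF that] by simp
  qed
  have X_mono: "X I \<subseteq> X J" if "I \<subseteq> J" for I J
    unfolding X_def using that by blast
  have X_Int: "X I \<inter> X J = X (I \<inter> J)" for I J
    unfolding X_def by blast
  have X_axis: "axis (e i) 1 \<in> X I" "- axis (e i) 1 \<in> X I" if "i \<in> I" "i < n" for i I
    unfolding X_def using that by (auto simp: axis_def inj)

  \<comment> \<open>Layout: 0 and 1 each lie in one of the two intersections; 2 and 3 are the
    special vectors of the two smallest subspaces, followed by \<open>a - 1\<close> more for each;
    then \<open>K\<close> with \<open>d - 1\<close> indices; then two blocks of length
    \<open>d\<close> that fill up the middle subspaces. This uses \<open>2 * a + 3 * d + 1\<close>
    indices, exactly the lower bound on \<open>n\<close>.\<close>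
  define K where "K = {2 * a + 2..<2 * a + 1 + d}"
  define IA1 where "IA1 = insert 2 {4..<a + 3}"
  define IA2 where "IA2 = insert 3 {a + 3..<2 * a + 2}"
  define IL1 where "IL1 = {2 * a + 1 + d..<2 * a + 1 + 2 * d}"
  define IL2 where "IL2 = {2 * a + 1 + 2 * d..<2 * a + 1 + 3 * d}"
  define IB1 where "IB1 = IA1 \<union> insert 0 K \<union> IL1"
  define IB2 where "IB2 = IA2 \<union> insert 1 K \<union> IL2"
  \<comment> \<open>Omitting \<open>IA2\<close> and \<open>IL2\<close> leaves just
    \<open>insert 1 K\<close> of \<open>IB2\<close>; \<open>IC2\<close> cuts \<open>IB1\<close> down
    to \<open>insert 0 K\<close> in the same way.\<close>
  define IC1 where "IC1 = {..<n} - (IA2 \<union> IL2)"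
  define IC2 where "IC2 = {..<n} - (IA1 \<union> IL1)"
  note I_defs = K_def IA1_def IA2_def IL1_def IL2_def
  have n': "2 * a + 3 * d + 1 \<le> n"
    using n unfolding n_def .
  have sub: "IA1 \<subseteq> IB1" "IB1 \<subseteq> IC1" "IC1 \<subseteq> {..<n}" "IA2 \<subseteq> IB2" "IB2 \<subseteq> IC2" "IC2 \<subseteq> {..<n}"
    using n' ad unfolding IB1_def IB2_def IC1_def IC2_def I_defs by auto
  have cA: "card IA1 = a" "card IA2 = a"
    using ad unfolding IA1_def IA2_def by auto
  have cL: "card IL1 = d" "card IL2 = d"
    unfolding IL1_def IL2_def by auto
  have cK: "card (insert i K) = d" if "i < 2" for i
    using ad that unfolding K_def by auto
  have disj: "(IA1 \<union> insert 0 K) \<inter> IL1 = {}" "(IA2 \<union> insert 1 K) \<inter> IL2 = {}"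
    "IA1 \<inter> insert 0 K = {}" "IA2 \<inter> insert 1 K = {}"
    using ad unfolding I_defs by auto
  have fin: "finite IA1" "finite IA2" "finite IL1" "finite IL2" "finite K"
    unfolding I_defs by auto
  have cB: "card IB1 = a + 2 * d" "card IB2 = a + 2 * d"
    unfolding IB1_def IB2_def using disj fin cA cL cK[of 0] cK[of 1]
    by (simp_all add: card_Un_disjoint del: card_insert_disjoint Un_insert_right)
  have "card (IA1 \<union> IL1) = a + d" "card (IA2 \<union> IL2) = a + d"
    using cA cL ad by (subst card_Un_disjoint; auto simp: I_defs)+
  moreover have "IA1 \<union> IL1 \<subseteq> {..<n}" "IA2 \<union> IL2 \<subseteq> {..<n}"
    using n' ad unfolding I_defs by auto
  ultimately have cC: "card IC1 = n - (a + d)" "card IC2 = n - (a + d)"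
    unfolding IC1_def IC2_def using fin by (simp_all add: card_Diff_subset)
  have sub': "IA1 \<subseteq> IC1" "IA2 \<subseteq> IC2" "IA1 \<subseteq> {..<n}" "IA2 \<subseteq> {..<n}"
    "IB1 \<subseteq> {..<n}" "IB2 \<subseteq> {..<n}"
    using sub by (meson order_trans)+
  have flags: "[X IA1, X IB1, X IC1] \<in> F" "[X IA2, X IB2, X IC2] \<in> F"
    unfolding F_def flag_variety_def n_def[symmetric] using sub sub' cA cB cC
    by (simp_all add: X_sub X_dim X_mono)
  have "IB1 \<inter> IC2 = insert 0 K" "IB2 \<inter> IC1 = insert 1 K"
    using n' ad unfolding IB1_def IB2_def IC1_def IC2_def I_defs by auto
  then have int: "X IB1 \<inter> X IC2 = X (insert 0 K)" "X IB2 \<inter> X IC1 = X (insert 1 K)"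
    by (simp_all only: X_Int)

  \<comment> \<open>For \<open>p\<close> \<noteq> \<open>q\<close>, basis vectors \<open>i\<close>
    and \<open>b p q i\<close> agree modulo \<open>C p q\<close>: 2 is paired with \<open>p\<close>,
    3 with \<open>q\<close>, and the rest of \<open>IA1\<close> with the rest of \<open>IA2\<close>
    by the shift \<open>a - 1\<close>. The vectors of \<open>K\<close> stay independent modulo
    \<open>C p q\<close>. There are (\<open>a + 1\<close>) + (\<open>d - 1\<close>)
    equations.\<close>
  define b where "b p q i = (if i = 2 then p else if i = 3 then q else i + (a - 1))" for p q i :: nat
  define C where "C p q = {v :: 'k ^ 'n. (\<forall>i\<in>{2..<a + 3}. vec_nth v (e i) = - vec_nth v (e (b p q i))) \<and>
    (\<forall>i\<in>K. vec_nth v (e i) = 0)}" for p q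
  have C: "vec.subspace (C p q)" "vec.dim (C p q) = n - (a + d)" if "p < 2" "q < 2" for p q
  proof -
    let ?T = "{2..<a + 3}"
    have IS: "?T \<union> K \<subseteq> {..<n}" "?T \<subseteq> {..<n}"
      using n' ad unfolding K_def by auto
    define \<beta> where "\<beta> r = e (b p q (inv_into {..<n} e r))" for r
    have \<beta>: "\<beta> (e i) = e (b p q i)" if "i < n" for i
      unfolding \<beta>_def using e that by (simp add: bij_betw_def inv_into_f_f)
    have b: "b p q i < n" "b p q i \<notin> ?T \<union> K" if "i \<in> ?T" for i
      using that \<open>p < 2\<close> \<open>q < 2\<close> n' ad unfolding b_def K_def by auto
    have disj: "\<beta> ` e ` ?T \<inter> e ` (?T \<union> K) = {}"
    proof -
      have "\<beta> (e i) \<notin> e ` (?T \<union> K)" if i: "i \<in> ?T" for i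
      proof -
        have "i < n" using i IS by blast
        show ?thesis
          unfolding \<beta>[OF \<open>i < n\<close>] e_in[OF b(1)[OF i] IS(1)] by (rule b(2)[OF i])
      qed
      then show ?thesis by blast
    qed
    have C_eq: "C p q = {v. \<forall>r\<in>e ` (?T \<union> K). vec_nth v r = (if r \<in> e ` ?T then - vec_nth v (\<beta> r) else 0)}"
    proof -
      have "?T \<inter> K = {}" using ad unfolding K_def by auto
      then have "(\<forall>r\<in>e ` (?T \<union> K). vec_nth v r = (if r \<in> e ` ?T then - vec_nth v (\<beta> r) else 0)) \<longleftrightarrow>
          (\<forall>i\<in>?T. vec_nth v (e i) = - vec_nth v (e (b p q i))) \<and> (\<forall>i\<in>K. vec_nth v (e i) = 0)" for v :: "'k ^ 'n"
        using IS by (auto simp: ball_Un e_in \<beta> subset_iff simp del: atLeastLessThan_iff)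
      then show ?thesis unfolding C_def by simp
    qed
    have card: "card (e ` (?T \<union> K)) = a + d"
      unfolding card_e[OF IS(1)] by (subst card_Un_disjoint) (use ad in \<open>auto simp: K_def\<close>)
    have "e ` ?T \<subseteq> e ` (?T \<union> K)" by blast
    note graph = graph_subspace[OF this disj, where 'k = 'k]
    show "vec.subspace (C p q)"
      unfolding C_eq by (rule graph(1))
    show "vec.dim (C p q) = n - (a + d)"
      unfolding C_eq n_def card[symmetric] by (rule graph(2))
  qed
  have CD: "vec_nth v (e 2) = - vec_nth v (e p)" "vec_nth v (e 3) = - vec_nth v (e q)"
    "\<And>i. i \<in> {4..<a + 3} \<Longrightarrow> vec_nth v (e i) = - vec_nth v (e (i + (a - 1)))"
    "\<And>i. i \<in> K \<Longrightarrow> vec_nth v (e i) = 0" if "v \<in> C p q" for v p q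
  proof -
    have T: "vec_nth v (e i) = - vec_nth v (e (b p q i))" if "i \<in> {2..<a + 3}" for i
      using \<open>v \<in> C p q\<close> that unfolding C_def by blast
    show "vec_nth v (e 2) = - vec_nth v (e p)"
      using T[of 2] unfolding b_def by simp
    show "vec_nth v (e 3) = - vec_nth v (e q)"
      using T[of 3] ad unfolding b_def by simp
    show "vec_nth v (e i) = - vec_nth v (e (i + (a - 1)))" if "i \<in> {4..<a + 3}" for i
      using T[of i] that unfolding b_def by simp
    show "vec_nth v (e i) = 0" if "i \<in> K" for i
      using \<open>v \<in> C p q\<close> that unfolding C_def by blast
  qed
  have XD: "vec_nth x (e i) = 0" if "x \<in> X I" "i < n" "i \<notin> I" for x I i
    using that unfolding X_def by blast

  \<comment> \<open>Incidences for the two pairings\<close>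
  have meet: "meets (X IA1) (C p q) (X (insert p K))" if pq: "p < 2" "q < 2" "p \<noteq> q" for p q
  proof -
    have 2: "2 < n" "p < n" "p \<noteq> 2" using n' ad pq by auto
    \<comment> \<open>The difference of the paired basis vectors 2 and \<open>p\<close> lies in
      \<open>C p q\<close>.\<close>
    let ?x = "axis (e 2) 1 :: 'k ^ 'n" and ?u = "- axis (e p) 1 :: 'k ^ 'n"
    have v: "vec_nth (?x + ?u) (e i) = (if i = 2 then 1 else if i = p then - 1 else 0)" if "i < n" for i
      using that 2 by (simp add: axis_def inj)
    have "vec_nth (?x + ?u) (e i) = - vec_nth (?x + ?u) (e (b p q i))" if i: "i \<in> {2..<a + 3}" for i
    proof -
      have "i < n" "b p q i < n" using i pq n' ad unfolding b_def by auto
      moreover have "b p q i \<noteq> 2" "b p q i = p \<longleftrightarrow> i = 2" "i \<noteq> p"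
        using i pq unfolding b_def by auto
      ultimately show ?thesis unfolding v[OF \<open>i < n\<close>] v[OF \<open>b p q i < n\<close>] by simp
    qed
    moreover have "vec_nth (?x + ?u) (e i) = 0" if "i \<in> K" for i
    proof -
      have "i < n" "i \<noteq> 2" "i \<noteq> p" using that pq n' ad unfolding K_def by auto
      then show ?thesis using v by simp
    qed
    ultimately have "?x + ?u \<in> C p q"
      unfolding C_def by blast
    moreover have "?x \<in> X IA1" "?u \<in> X (insert p K)"
      using 2 by (auto intro!: X_axis simp: IA1_def)
    moreover have "?x \<noteq> 0"
      by (simp add: axis_eq_0_iff)
    ultimately show ?thesis
      unfolding meets_def by blast
  qed
  \<comment> \<open>The equations on \<open>K\<close> and the one for 3 kill \<open>u\<close>, as
    \<open>x\<close> has no coordinates at those indices nor at \<open>q\<close>. The remaining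
    equations then kill \<open>x\<close>, whose indices are paired with indices outside
    \<open>IA1\<close>.\<close>
  have apart1: "\<not> meets (X IA1) (C p q) (X (insert q K))" if pq: "p < 2" "q < 2" "p \<noteq> q" for p q
  proof -
    have "x = 0 \<and> u = 0" if x: "x \<in> X IA1" and u: "u \<in> X (insert q K)" and xu: "x + u \<in> C p q" for x u
    proof -
      have K0: "vec_nth u (e i) = 0" if "i \<in> K" for i
        using CD(4)[OF xu that] XD[OF x, of i] that n' ad unfolding I_defs by auto
      have "vec_nth u (e q) = 0"
        using CD(2)[OF xu] XD[OF x, of 3] XD[OF x, of q] XD[OF u, of 3] pq n' ad unfolding I_defs by auto
      then have u0: "u = 0"
        using K0 XD[OF u] by (intro eq0) blast
      have "vec_nth x (e 2) = 0"
        using CD(1)[OF xu] XD[OF x, of p] u0 pq n' ad unfolding I_defs by auto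
      moreover have "vec_nth x (e i) = 0" if "i \<in> {4..<a + 3}" for i
      proof -
        have "i + (a - 1) < n" "i + (a - 1) \<notin> IA1"
          using that n' ad unfolding I_defs by auto
        then show ?thesis
          using CD(3)[OF xu that] XD[OF x] u0 by simp
      qed
      ultimately have "x = 0"
        using XD[OF x] unfolding IA1_def by (intro eq0) blast
      with u0 show ?thesis by simp
    qed
    then show ?thesis unfolding meets_def by blast
  qed
  have apart2: "\<not> meets (X IA2) (C p q) (X (insert p K))" if pq: "p < 2" "q < 2" "p \<noteq> q" for p q
  proof -
    have "x = 0 \<and> u = 0" if x: "x \<in> X IA2" and u: "u \<in> X (insert p K)" and xu: "x + u \<in> C p q" for x u
    proof -
      have K0: "vec_nth u (e i) = 0" if "i \<in> K" for i
        using CD(4)[OF xu that] XD[OF x, of i] that n' ad unfolding I_defs by auto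
      have "vec_nth u (e p) = 0"
        using CD(1)[OF xu] XD[OF x, of 2] XD[OF x, of p] XD[OF u, of 2] pq n' ad unfolding I_defs by auto
      then have u0: "u = 0"
        using K0 XD[OF u] by (intro eq0) blast
      have "vec_nth x (e 3) = 0"
        using CD(2)[OF xu] XD[OF x, of q] u0 pq n' ad unfolding I_defs by auto
      moreover have "vec_nth x (e i) = 0" if "i \<in> {a + 3..<2 * a + 2}" for i
      proof -
        \<comment> \<open>The equations are indexed by the \<open>IA1\<close> side, so the shift is
          undone.\<close>
        define j where "j = i - (a - 1)"
        have j: "j \<in> {4..<a + 3}" "j + (a - 1) = i"
          using that ad unfolding j_def by auto
        then show ?thesis
          using CD(3)[OF xu j(1)] XD[OF x, of j] u0 n' ad unfolding j(2) I_defs by auto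
      qed
      ultimately have "x = 0"
        using XD[OF x] unfolding IA2_def by (intro eq0) blast
      with u0 show ?thesis by simp
    qed
    then show ?thesis unfolding meets_def by blast
  qed
  \<comment> \<open>\<open>C 0 1\<close> pairs each smallest subspace with the intersection inside
    its own flag's middle subspace, \<open>C 1 0\<close> with the other one.\<close>
  show ?thesis
    by (rule that[of "X IA1" "X IB1" "X IC1" "X IA2" "X IB2" "X IC2" "C 0 1" "C 1 0"])
      (use flags C meet[of 0 1] meet[of 1 0] apart1[of 0 1] apart1[of 1 0] apart2[of 0 1] apart2[of 1 0]
       in \<open>simp_all add: int n_def\<close>)
qed


section \<open>The closure of an orbit\<close>

lemma hom_coordsE:
  fixes Ws :: "('k::field ^ 'n) set list"
  assumes "p \<in> hom_coords Ws"
  obtains Bs where "\<And>i. i < length Ws \<Longrightarrow> is_basis (Bs i) (Ws ! i)"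
    "\<And>i. i < length Ws \<Longrightarrow> p i = pluecker (Bs i)"
    "\<And>i. i < length Ws \<Longrightarrow> length (Bs i) = vec.dim (Ws ! i)"
  using assms length_is_basis unfolding hom_coords_def by fastforce

lemma is_basis_image:
  fixes A :: "'k::field ^ 'n ^ 'n"
  assumes "is_basis ws W" "invertible A"
  shows "is_basis (map ((*v) A) ws) ((*v) A ` W)"
proof -
  have inj: "inj ((*v) A)"
    using assms(2) unfolding invertible_def by (metis matrix_left_invertible_injective)
  have lin: "Vector_Spaces.linear (*s) (*s) ((*v) A)"
    by (rule matrix_vector_mul_linear_gen)
  have "vec.independent ((*v) A ` set ws)"
    by (rule vec.linear_independent_injective_image[OF lin])
      (use assms(1) inj in \<open>auto simp: is_basis_def intro: inj_on_subset\<close>)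
  then show ?thesis
    using assms(1) inj unfolding is_basis_def
    by (auto simp: distinct_map vec.linear_span_image[OF lin] intro: inj_on_subset)
qed

text \<open>The zero locus of a multiform is closed, so it contains the closure of
  \<open>Y\<close>.\<close>

lemma vanishes_on_closure:
  fixes X :: "('k::field ^ 'n) set list list set"
  assumes X: "X \<subseteq> self_product m (flag_variety ks)"
    and dense: "zariski X closure_of Y = X"
    and f: "f \<in> multiforms" and Y: "Y \<subseteq> zero_locus X {f}"
    and z: "z \<in> X" "q \<in> hom_coords (concat z)"
  shows "f q = 0"
proof -
  have "closedin (zariski X) (zero_locus X {f})"
    unfolding closedin_zariski[OF X] using f by blast
  then have "X \<subseteq> zero_locus X {f}"
    using closure_of_minimal[OF Y] dense by blast
  then show ?thesis
    using z unfolding zero_locus_def by blast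
qed

text \<open>Transporting fixed bases of the subspaces in \<open>x\<close> by a representative matrix
  gives one coordinate system at each orbit point; \<open>multiform_vanishes_iff\<close> extends
  vanishing to all systems there.\<close>

lemma orbit_zero_locusI:
  fixes x :: "('k::field ^ 'n) set list list"
  assumes X: "X = self_product m (flag_variety ks)" and x: "x \<in> X"
    and Bs: "\<And>i. i < length (concat x) \<Longrightarrow> is_basis (Bs i) (concat x ! i)"
    and f: "f \<in> multiforms"
    and zero: "\<And>A p. invertible A \<Longrightarrow>
      (\<And>i. i < length (concat x) \<Longrightarrow> p i = pluecker (map ((*v) A) (Bs i))) \<Longrightarrow> f p = 0"
  shows "Group_Action.orbit PGL diagonal_act x \<subseteq> zero_locus X {f}"
proof
  fix y assume "y \<in> Group_Action.orbit PGL diagonal_act x"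
  then obtain A where A: "invertible A" "y = diagonal_act (scalar_matrices #>\<^bsub>GL\<^esub> A) x"
    unfolding Group_Action.orbit_def carrier_PGL by auto
  then have y: "y = map (map ((`) ((*v) A))) x"
    using diagonal_act_coset x unfolding X by blast
  define p where "p i = (if i < length (concat x) then pluecker (map ((*v) A) (Bs i)) else (\<lambda>_. 0))" for i
  have cy: "concat y = map ((`) ((*v) A)) (concat x)"
    unfolding y by (simp add: map_concat)
  have "p \<in> hom_coords (concat y)"
    unfolding hom_coords_def cy p_def
    by (intro CollectI exI[of _ "\<lambda>i. map ((*v) A) (Bs i)"] conjI) (auto simp: is_basis_image[OF Bs A(1)])
  moreover have "f p = 0"
    by (rule zero[OF A(1)]) (simp add: p_def)
  moreover have "y \<in> X"
    using map_image_flag x A(1) unfolding X y by blast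
  ultimately show "y \<in> zero_locus X {f}"
    unfolding zero_locus_def using multiform_vanishes_iff[OF f] by blast
qed


theorem corollary4p5:
  fixes a b :: nat
  assumes "0 < a" and "a < b" and "even (a + b)"
    and "b < CARD('n::finite) - (a + b) div 2"
  shows "\<not> dense_action (self_product 3 (flag_variety [a, b, CARD('n) - (a + b) div 2])
           :: ('k::alg_closed_field ^ 'n) set list list set)"
proof
  \<comment> \<open>\<open>d\<close> is the generic dimension of the intersections
    \<open>K\<^sub>1\<close>, \<open>K\<^sub>2\<close>, and \<open>a + d\<close> is the mean of
    \<open>a\<close> and \<open>b\<close>.\<close>
  define d where "d = (b - a) div 2"
  define c where "c = CARD('n) - (a + d)"
  have "b = a + 2 * d"
    using assms(2,3) unfolding d_def by presburger
  then have d: "0 < d" "b = a + 2 * d" "(a + b) div 2 = a + d"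
    using assms(2) by auto
  \<comment> \<open>The equation in the middle makes the incidence matrices square; the last bound
    leaves room for the configurations.\<close>
  have c: "b < c" "a + c + b + c = 2 * CARD('n)" and n: "2 * a + 3 * d + 1 \<le> CARD('n)"
    using assms(4) d unfolding c_def by auto
  define F where "F = (flag_variety [a, b, c] :: ('k ^ 'n) set list set)"
  define X where "X = self_product 3 F"
  assume "dense_action (self_product 3 (flag_variety [a, b, CARD('n) - (a + b) div 2])
    :: ('k ^ 'n) set list list set)"
  then obtain x where x: "x \<in> X" "zariski X closure_of Group_Action.orbit PGL diagonal_act x = X"
    unfolding dense_action_def X_def F_def c_def d(3) by blast

  \<comment> \<open>The brackets as multiforms in nine blocks of coordinates\<close>
  have dims: "map vec.dim (concat z) = [a, b, c, a, b, c, a, b, c]" if "z \<in> X" for z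
  proof -
    have len: "length z = 3" and F: "\<And>Ws. Ws \<in> set z \<Longrightarrow> map vec.dim Ws = [a, b, c]"
      using that unfolding X_def F_def self_product_def flag_variety_def by auto
    have "map vec.dim (concat z) = concat (map (map vec.dim) z)"
      by (simp add: map_concat)
    also have "map (map vec.dim) z = map (\<lambda>_. [a, b, c]) z"
      using F by simp
    also have "\<dots> = [[a, b, c], [a, b, c], [a, b, c]]"
      using len by (auto simp: numeral_3_eq_3 length_Suc_conv)
    finally show ?thesis by simp
  qed
  have len: "length (concat z) = 9" if "z \<in> X" for z
    using arg_cong[OF dims[OF that], of length] by simp
  have dim: "vec.dim (concat z ! i) = [a, b, c, a, b, c, a, b, c] ! i" if "z \<in> X" "i < 9" for z i
    using dims[OF that(1)] len[OF that(1)] that(2) by (metis nth_map)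

  \<comment> \<open>Positions 0 to 8 of the concatenated list are the three subspaces of each flag
    in turn, so 8 is \<open>C\<^sub>3\<close>. The form for \<open>i\<close>, \<open>k\<close>,
    \<open>l\<close> is the bracket of subspace \<open>i\<close> with the intersection of subspaces
    \<open>k\<close> and \<open>l\<close>.\<close>
  define incidence_form where "incidence_form i k l f \<longleftrightarrow>
    multihom (\<lambda>j. unit_degree i j + (unit_degree 8 j + (unit_degree k j + unit_degree l j))) f \<and>
    (\<forall>p As Cs Bs Ds. p i = pluecker As \<longrightarrow> p 8 = pluecker Cs \<longrightarrow> p k = pluecker Bs \<longrightarrow> p l = pluecker Ds \<longrightarrow>
      length As = a \<longrightarrow> length Cs = c \<longrightarrow> length Bs = b \<longrightarrow> length Ds = c \<longrightarrow>
      f p = incidence_det As Cs Bs Ds)"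
    for i k l :: nat and f :: "(nat \<Rightarrow> 'n list \<Rightarrow> 'k) \<Rightarrow> 'k"
  have form_ex: "\<exists>f. incidence_form i k l f" for i k l
    unfolding incidence_form_def
    by (rule incidence_det_multihom[of i 8 k l a c b c]) (rule exI, rule conjI, assumption, blast)
  define T where "T i k l = (SOME f. incidence_form i k l f)" for i k l
  have form: "incidence_form i k l (T i k l)" for i k l
    unfolding T_def by (rule someI_ex[OF form_ex])
  have T_hom: "multihom (\<lambda>j. unit_degree i j +
      (unit_degree 8 j + (unit_degree k j + unit_degree l j))) (T i k l)" for i k l
    using form unfolding incidence_form_def by (rule conjunct1)
  have T: "T i k l p = incidence_det As Cs Bs Ds"
    if "p i = pluecker As" "p 8 = pluecker Cs" "p k = pluecker Bs" "p l = pluecker Ds"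
      "length As = a" "length Cs = c" "length Bs = b" "length Ds = c" for i k l p As Cs Bs Ds
    using form[of i k l] that unfolding incidence_form_def by blast
  \<comment> \<open>Numerator and denominator of the cross ratio: (1, 5) stands for
    \<open>K\<^sub>1\<close> and (4, 2) for \<open>K\<^sub>2\<close>.\<close>
  define N where "N p = T 0 1 5 p * T 3 4 2 p" for p
  define D where "D p = T 0 4 2 p * T 3 1 5 p" for p
  \<comment> \<open>Both products use blocks 0 to 5 once and block 8 twice, so their linear
    combinations are multiforms.\<close>
  define e where "e j = unit_degree 0 j + (unit_degree 8 j + (unit_degree 1 j + unit_degree 5 j)) +
    (unit_degree 3 j + (unit_degree 8 j + (unit_degree 4 j + unit_degree 2 j)))" for j :: nat
  have "multihom e N"
    unfolding N_def e_def by (rule multihom.mult[OF T_hom T_hom])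
  have "multihom e D"
  proof -
    have "e = (\<lambda>j. unit_degree 0 j + (unit_degree 8 j + (unit_degree 4 j + unit_degree 2 j)) +
      (unit_degree 3 j + (unit_degree 8 j + (unit_degree 1 j + unit_degree 5 j))))"
      unfolding e_def by auto
    then show ?thesis
      unfolding D_def using multihom.mult[OF T_hom T_hom, of 0 4 2 3 1 5] by simp
  qed
  have ND: "(\<lambda>p. \<alpha> * N p + \<beta> * D p) \<in> multiforms" for \<alpha> \<beta>
    unfolding multiforms_def
    using multihom.add[OF multihom_cmult[OF \<open>multihom e N\<close>] multihom_cmult[OF \<open>multihom e D\<close>]] by blast

  \<comment> \<open>A linear relation between numerator and denominator on the orbit\<close>
  have "hom_coords (concat x) \<noteq> {}"
    by (rule hom_coords_nonempty)
      (use x in \<open>auto simp: X_def F_def self_product_def flag_variety_def\<close>)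
  then obtain p\<^sub>0 where "p\<^sub>0 \<in> hom_coords (concat x)" by blast
  then obtain Bs where Bs: "\<And>i. i < 9 \<Longrightarrow> is_basis (Bs i) (concat x ! i)"
    "\<And>i. i < 9 \<Longrightarrow> p\<^sub>0 i = pluecker (Bs i)"
    "\<And>i. i < 9 \<Longrightarrow> length (Bs i) = [a, b, c, a, b, c, a, b, c] ! i"
    using hom_coordsE len[OF x(1)] dim[OF x(1)] by metis
  \<comment> \<open>The pair encodes the value of the cross ratio at \<open>x\<close> as a point of
    the projective line; if both products vanish there, any nonzero pair serves.\<close>
  obtain \<alpha> \<beta> where \<alpha>\<beta>: "\<alpha> * N p\<^sub>0 + \<beta> * D p\<^sub>0 = 0" "\<alpha> \<noteq> 0 \<or> \<beta> \<noteq> 0"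
  proof (cases "N p\<^sub>0 = 0 \<and> D p\<^sub>0 = 0")
    case True
    then show ?thesis using that[of 1 0] by simp
  next
    case False
    show ?thesis
      by (rule that[of "D p\<^sub>0" "- N p\<^sub>0"]) (use False in \<open>auto simp: mult.commute\<close>)
  qed
  have "Group_Action.orbit PGL diagonal_act x \<subseteq> zero_locus X {\<lambda>p. \<alpha> * N p + \<beta> * D p}"
  proof (rule orbit_zero_locusI[OF _ x(1) _ ND])
    show "X = self_product 3 (flag_variety [a, b, c])"
      unfolding X_def F_def ..
    show "is_basis (Bs i) (concat x ! i)" if "i < length (concat x)" for i
      using Bs(1) that len[OF x(1)] by simp
  next
    fix A :: "'k ^ 'n ^ 'n" and p
    assume "\<And>i. i < length (concat x) \<Longrightarrow> p i = pluecker (map ((*v) A) (Bs i))"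
    then have p: "p i = pluecker (map ((*v) A) (Bs i))" if "i < 9" for i
      using that len[OF x(1)] by simp
    obtain \<mu> where \<mu>: "\<And>As Bs Cs Ds. length As + length Cs + length Bs + length Ds = 2 * CARD('n) \<Longrightarrow>
      incidence_det (map ((*v) A) As) (map ((*v) A) Cs) (map ((*v) A) Bs) (map ((*v) A) Ds) =
      \<mu> * incidence_det As Cs Bs Ds"
      by (rule incidence_det_equivariant[of A]) blast
    \<comment> \<open>All four brackets scale by the same \<mu>, hence \<open>N\<close> and
      \<open>D\<close> both by its square, and the relation persists along the orbit.\<close>
    have "T i k l p = \<mu> * T i k l p\<^sub>0"
      if "i \<in> {0, 3}" "k \<in> {1, 4}" "l \<in> {2, 5}" for i k l
    proof -
      have i: "i < 9" "k < 9" "l < 9" "(8 :: nat) < 9" using that by auto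
      have ln: "length (Bs i) = a" "length (Bs 8) = c" "length (Bs k) = b" "length (Bs l) = c"
        using Bs(3)[OF i(1)] Bs(3)[OF i(2)] Bs(3)[OF i(3)] Bs(3)[OF i(4)] that by auto
      have "T i k l p = incidence_det (map ((*v) A) (Bs i)) (map ((*v) A) (Bs 8))
          (map ((*v) A) (Bs k)) (map ((*v) A) (Bs l))"
        by (rule T) (use i ln p in auto)
      also have "\<dots> = \<mu> * incidence_det (Bs i) (Bs 8) (Bs k) (Bs l)"
        by (rule \<mu>) (use ln c(2) in simp)
      also have "incidence_det (Bs i) (Bs 8) (Bs k) (Bs l) = T i k l p\<^sub>0"
        by (rule T[symmetric]) (use i ln Bs(2) in auto)
      finally show ?thesis .
    qed
    then have "N p = \<mu> * \<mu> * N p\<^sub>0" "D p = \<mu> * \<mu> * D p\<^sub>0"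
      unfolding N_def D_def by simp_all
    then have "\<alpha> * N p + \<beta> * D p = \<mu> * \<mu> * (\<alpha> * N p\<^sub>0 + \<beta> * D p\<^sub>0)"
      by (simp add: algebra_simps)
    then show "\<alpha> * N p + \<beta> * D p = 0"
      using \<alpha>\<beta>(1) by simp
  qed
  then have vanish: "\<alpha> * N q + \<beta> * D q = 0" if "z \<in> X" "q \<in> hom_coords (concat z)" for z q
    using vanishes_on_closure[OF _ x(2) ND _ that] unfolding X_def F_def by blast

  \<comment> \<open>Two points with cross ratio zero and infinity\<close>
  obtain A\<^sub>1 B\<^sub>1 C\<^sub>1 A\<^sub>2 B\<^sub>2 C\<^sub>2 C\<^sub>3 C\<^sub>3' :: "('k ^ 'n) set" where
    F12: "[A\<^sub>1, B\<^sub>1, C\<^sub>1] \<in> F" "[A\<^sub>2, B\<^sub>2, C\<^sub>2] \<in> F" and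
    C3: "vec.subspace C\<^sub>3" "vec.dim C\<^sub>3 = c" "vec.subspace C\<^sub>3'" "vec.dim C\<^sub>3' = c" and
    meets: "meets A\<^sub>1 C\<^sub>3 (B\<^sub>1 \<inter> C\<^sub>2)" "\<not> meets A\<^sub>1 C\<^sub>3 (B\<^sub>2 \<inter> C\<^sub>1)" "\<not> meets A\<^sub>2 C\<^sub>3 (B\<^sub>1 \<inter> C\<^sub>2)" and
    meets': "meets A\<^sub>1 C\<^sub>3' (B\<^sub>2 \<inter> C\<^sub>1)" "\<not> meets A\<^sub>1 C\<^sub>3' (B\<^sub>1 \<inter> C\<^sub>2)" "\<not> meets A\<^sub>2 C\<^sub>3' (B\<^sub>2 \<inter> C\<^sub>1)"
    unfolding F_def c_def d(2) by (rule configurations[OF assms(1) d(1) n]) blast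
  \<comment> \<open>The brackets see only the largest subspace of the third flag, so the two smaller
    ones may be chosen arbitrarily inside it.\<close>
  have point: "\<exists>z\<in>X. \<exists>q\<in>hom_coords (concat z).
      (T 0 1 5 q = 0 \<longleftrightarrow> meets A\<^sub>1 C (B\<^sub>1 \<inter> C\<^sub>2)) \<and> (T 3 4 2 q = 0 \<longleftrightarrow> meets A\<^sub>2 C (B\<^sub>2 \<inter> C\<^sub>1)) \<and>
      (T 0 4 2 q = 0 \<longleftrightarrow> meets A\<^sub>1 C (B\<^sub>2 \<inter> C\<^sub>1)) \<and> (T 3 1 5 q = 0 \<longleftrightarrow> meets A\<^sub>2 C (B\<^sub>1 \<inter> C\<^sub>2))"
    if C: "vec.subspace C" "vec.dim C = c" for C
  proof -
    obtain B where B: "vec.subspace B" "B \<subseteq> C" "vec.dim B = b"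
      using subspace_of_dim[OF C(1), of b] C(2) c(1) by auto
    obtain A where A: "vec.subspace A" "A \<subseteq> B" "vec.dim A = a"
      using subspace_of_dim[OF B(1), of a] B(3) assms(2) by auto
    define z where "z = [[A\<^sub>1, B\<^sub>1, C\<^sub>1], [A\<^sub>2, B\<^sub>2, C\<^sub>2], [A, B, C]]"
    have "[A, B, C] \<in> F"
      using A B C unfolding F_def flag_variety_def by auto
    then have z: "z \<in> X"
      using F12 unfolding X_def self_product_def z_def by simp
    have cz: "concat z = [A\<^sub>1, B\<^sub>1, C\<^sub>1, A\<^sub>2, B\<^sub>2, C\<^sub>2, A, B, C]"
      unfolding z_def by simp
    have "hom_coords (concat z) \<noteq> {}"
      by (rule hom_coords_nonempty)
        (use z in \<open>auto simp: X_def F_def self_product_def flag_variety_def\<close>)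
    then obtain q where q: "q \<in> hom_coords (concat z)" by blast
    then obtain Es where Es: "\<And>i. i < 9 \<Longrightarrow> is_basis (Es i) (concat z ! i)"
      "\<And>i. i < 9 \<Longrightarrow> q i = pluecker (Es i)"
      "\<And>i. i < 9 \<Longrightarrow> length (Es i) = [a, b, c, a, b, c, a, b, c] ! i"
      using hom_coordsE len[OF z] dim[OF z] by metis
    have "T i k l q = 0 \<longleftrightarrow> meets (concat z ! i) (concat z ! 8) (concat z ! k \<inter> concat z ! l)"
      if "i \<in> {0, 3}" "k \<in> {1, 4}" "l \<in> {2, 5}" for i k l
    proof -
      have i: "i < 9" "k < 9" "l < 9" "(8 :: nat) < 9" using that by auto
      have ln: "length (Es i) = a" "length (Es 8) = c" "length (Es k) = b" "length (Es l) = c"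
        using Es(3)[OF i(1)] Es(3)[OF i(2)] Es(3)[OF i(3)] Es(3)[OF i(4)] that by auto
      have "T i k l q = incidence_det (Es i) (Es 8) (Es k) (Es l)"
        by (rule T) (use i ln Es(2) in auto)
      also have "\<dots> = 0 \<longleftrightarrow> meets (concat z ! i) (concat z ! 8) (concat z ! k \<inter> concat z ! l)"
        unfolding meets_def
        by (rule incidence_det_eq_0_iff) (use i ln Es(1) c(2) in auto)
      finally show ?thesis .
    qed
    note this[of 0 1 5] this[of 3 4 2] this[of 0 4 2] this[of 3 1 5]
    then show ?thesis
      using z q unfolding cz by (intro bexI[of _ z] bexI[of _ q]) (simp_all add: cz)
  qed
  obtain y q where y: "y \<in> X" "q \<in> hom_coords (concat y)" "N q = 0" "D q \<noteq> 0"
    using point[OF C3(1,2)] meets unfolding N_def D_def by (metis mult_eq_0_iff)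
  obtain z r where z: "z \<in> X" "r \<in> hom_coords (concat z)" "N r \<noteq> 0" "D r = 0"
    using point[OF C3(3,4)] meets' unfolding N_def D_def by (metis mult_eq_0_iff)
  \<comment> \<open>The relation forces \<beta> = 0 at the first point and \<alpha> = 0 at the
    second.\<close>
  show False
    using vanish[OF y(1,2)] vanish[OF z(1,2)] y z \<alpha>\<beta>(2) by simp
qed

end
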